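(* Let $s\in(0,\infty)$, $r\in\mathbb N$ with $r>s$, $f\in\Lambda_s$, and assume the regularity $L$ of the Daubechies wavelet system satisfies $L\ge r-1$. Then there exist constants $c\in(0,1)$, $m\in\mathbb N$ and $R\in(1,\infty)$, independent of $f$ and $j$, such that for any $\varepsilon\in(0,\infty)$ and $j\in\mathbb Z_+$, $$T_j(s,f,\varepsilon)\subset\bigcup_{i=j+1}^{j+m}\big[S_{r,i}(s,f,c\varepsilon)\big]_R.$$
   Context: $\Delta_hf(x):=f(x+h/2)-f(x-h/2)$, $\Delta^{k+1}_h:=\Delta^k_h\Delta_h$, $\Delta_rf(x,y):=\sup_{|h|=y}|\Delta_h^rf(x)|$. $\Lambda_s$: bounded continuous $f$ with $\|f\|_{L^\infty}+\sup_{x,\,y\in(0,1]}\Delta_{\lfloor s\rfloor+1}f(x,y)/y^s<\infty$. $S_{r,i}(s,f,\varepsilon):=\{(x,y)\in\mathbb R^n\times(0,\infty):\Delta_rf(x,y)/y^s>\varepsilon,\ y\in(2^{-i-1},2^{-i}]\}$. $\mathcal D_j=\{2^{-j}(k+[0,1)^n):k\in\mathbb Z^n\}$; $\ell(I)$ side length; $T(I):=I\times(\ell(I)/2,\ell(I)]$. Daubechies wavelet system of regularity $L$ ($\varphi,\psi_\ell\in C^L_c$, $\ell=1,\dots,2^n-1$, vanishing moments up to order $L$, orthonormal basis of $L^2$ together with integer translates of $\varphi$); for $I=2^{-j}(k+[0,1)^n)$, $\psi_{(\ell,I)}:=2^{jn/2}\psi_\ell(2^j\cdot-k)$. $W_j(s,f,\varepsilon):=\{I\in\mathcal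 D_j:\max_{1\le\ell<2^n}|\int f\psi_{(\ell,I)}|>\varepsilon|I|^{s/n+1/2}\}$ and $T_j(s,f,\varepsilon):=\bigcup_{I\in W_j(s,f,\varepsilon)}T(I)$. Hyperbolic metric $\rho(\mathbf x,\mathbf y)=\operatorname{arccosh}(1+\frac{|\mathbf x-\mathbf y|^2}{2x_{n+1}y_{n+1}})$ on $\mathbb R^n\times(0,\infty)$; $A_R:=\{\mathbf x:\inf_{\mathbf y\in A}\rho(\mathbf x,\mathbf y)<R\}$. *)

theory Defs
  imports "HOL-Analysis.Analysis"
begin

fun Ck :: "nat \<Rightarrow> (real^'n \<Rightarrow> real) \<Rightarrow> bool" where
  "Ck 0 f = continuous_on UNIV f"
| "Ck (Suc k) f = (continuous_on UNIV f \<and>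
     (\<exists>D :: 'n \<Rightarrow> real^'n \<Rightarrow> real.
        (\<forall>i x. ((\<lambda>t. f (x + t *\<^sub>R axis i 1)) has_real_derivative D i x) (at 0))
        \<and> (\<forall>i. Ck k (D i))))"

definition compact_supp :: "(real^'n \<Rightarrow> real) \<Rightarrow> bool" where
  "compact_supp g \<longleftrightarrow> compact (closure {x. g x \<noteq> 0})"

definition monom :: "('n::finite \<Rightarrow> nat) \<Rightarrow> real^'n \<Rightarrow> real" where
  "monom \<alpha> x = (\<Prod>i\<in>UNIV. (x $ i) ^ (\<alpha> i))"

definition dcube :: "int \<Rightarrow> ('n::finite \<Rightarrow> int) \<Rightarrow> (real^'n) set" where
  "dcube j k = {x. \<forall>i. 2 powr (- real_of_int j) * of_int (k i) \<le> x $ i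
                   \<and> x $ i < 2 powr (- real_of_int j) * (of_int (k i) + 1)}"

definition dyadic :: "int \<Rightarrow> ((real^'n::finite) set) set" where
  "dyadic j = {dcube j k | k. True}"

definition wav :: "(real^'n::finite \<Rightarrow> real) \<Rightarrow> int \<Rightarrow> ('n \<Rightarrow> int) \<Rightarrow> real^'n \<Rightarrow> real" where
  "wav g j k x = 2 powr (real_of_int j * real CARD('n) / 2)
                 * g (2 powr (real_of_int j) *\<^sub>R x - (\<chi> i. of_int (k i)))"

definition L2inner :: "(real^'n::finite \<Rightarrow> real) \<Rightarrow> (real^'n \<Rightarrow> real) \<Rightarrow> real" where
  "L2inner g h = (LINT x|lborel. g x * h x)"

definition square_integrable :: "(real^'n::finite \<Rightarrow> real) \<Rightarrow> bool" where
  "square_integrable g \<longleftrightarrow> g \<in> borel_measurable lborel \<and> integrable lborel (\<lambda>x. (g x)^2)"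

text \<open>Daubechies wavelet system of regularity L. The system is indexed (to express
  orthonormality, distinct indices must give orthogonal functions):
  index Inl k  \<mapsto> phi(. - k);  index Inr (l,j,k) \<mapsto> psi_(l, 2^-j(k+[0,1)^n)).\<close>
definition wav_elem :: "(real^'n::finite \<Rightarrow> real) \<Rightarrow> (nat \<Rightarrow> real^'n \<Rightarrow> real)
     \<Rightarrow> ('n \<Rightarrow> int) + (nat \<times> nat \<times> ('n \<Rightarrow> int)) \<Rightarrow> real^'n \<Rightarrow> real" where
  "wav_elem \<phi> \<psi> idx = (case idx of Inl k \<Rightarrow> wav \<phi> 0 k
                        | Inr (l, j, k) \<Rightarrow> wav (\<psi> l) (int j) k)"

definition wav_index :: "('n::finite \<Rightarrow> int) + (nat \<times> nat \<times> ('n \<Rightarrow> int)) \<Rightarrow> bool" where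
  "wav_index idx = (case idx of Inl k \<Rightarrow> True
                    | Inr (l, j, k) \<Rightarrow> 1 \<le> l \<and> l < 2 ^ CARD('n))"

definition daubechies :: "nat \<Rightarrow> (real^'n::finite \<Rightarrow> real) \<Rightarrow> (nat \<Rightarrow> real^'n \<Rightarrow> real) \<Rightarrow> bool" where
  "daubechies L \<phi> \<psi> \<longleftrightarrow>
     Ck L \<phi> \<and> compact_supp \<phi> \<and>
     (\<forall>l. 1 \<le> l \<and> l < 2 ^ CARD('n) \<longrightarrow> Ck L (\<psi> l) \<and> compact_supp (\<psi> l) \<and>
         (\<forall>\<alpha>::'n \<Rightarrow> nat. (\<Sum>i\<in>UNIV. \<alpha> i) \<le> L \<longrightarrow>
             (LINT x|lborel. monom \<alpha> x * \<psi> l x) = 0)) \<and>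
     (\<forall>a b. wav_index a \<longrightarrow> wav_index b \<longrightarrow>
         L2inner (wav_elem \<phi> \<psi> a) (wav_elem \<phi> \<psi> b) = (if a = b then 1 else 0)) \<and>
     (\<forall>g. square_integrable g \<longrightarrow>
         (\<forall>a. wav_index a \<longrightarrow> L2inner g (wav_elem \<phi> \<psi> a) = 0) \<longrightarrow>
         (AE x in lborel. g x = 0))"

definition Delta1 :: "real^'n \<Rightarrow> (real^'n \<Rightarrow> real) \<Rightarrow> real^'n \<Rightarrow> real" where
  "Delta1 h f x = f (x + (1/2) *\<^sub>R h) - f (x - (1/2) *\<^sub>R h)"

fun DeltaPow :: "nat \<Rightarrow> real^'n \<Rightarrow> (real^'n \<Rightarrow> real) \<Rightarrow> real^'n \<Rightarrow> real" where
  "DeltaPow 0 h f = f"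
| "DeltaPow (Suc k) h f = DeltaPow k h (Delta1 h f)"

definition DeltaR :: "nat \<Rightarrow> (real^'n \<Rightarrow> real) \<Rightarrow> real^'n \<Rightarrow> real \<Rightarrow> real" where
  "DeltaR r f x y = (SUP h\<in>{h. norm h = y}. \<bar>DeltaPow r h f x\<bar>)"

definition Lambda :: "real \<Rightarrow> (real^'n \<Rightarrow> real) set" where
  "Lambda s = {f. continuous_on UNIV f \<and> bounded (range f) \<and>
      (\<exists>C. \<forall>x y. 0 < y \<and> y \<le> 1 \<longrightarrow> DeltaR (nat \<lfloor>s\<rfloor> + 1) f x y / y powr s \<le> C)}"

definition S_set :: "nat \<Rightarrow> int \<Rightarrow> real \<Rightarrow> (real^'n \<Rightarrow> real) \<Rightarrow> real \<Rightarrow> ((real^'n) \<times> real) set" where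
  "S_set r i s f \<epsilon> = {(x, y). 0 < y \<and> DeltaR r f x y / y powr s > \<epsilon>
        \<and> 2 powr (- real_of_int i - 1) < y \<and> y \<le> 2 powr (- real_of_int i)}"

definition Tbox :: "int \<Rightarrow> ('n::finite \<Rightarrow> int) \<Rightarrow> ((real^'n) \<times> real) set" where
  "Tbox j k = dcube j k \<times> {2 powr (- real_of_int j) / 2 <.. 2 powr (- real_of_int j)}"

definition W_set :: "int \<Rightarrow> real \<Rightarrow> (nat \<Rightarrow> real^'n \<Rightarrow> real) \<Rightarrow> (real^'n::finite \<Rightarrow> real) \<Rightarrow> real
     \<Rightarrow> ('n \<Rightarrow> int) set" where
  "W_set j s \<psi> f \<epsilon> = {k. (MAX l\<in>{1..<2 ^ CARD('n)}.
        \<bar>LINT x|lborel. f x * wav (\<psi> l) j k x\<bar>)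
      > \<epsilon> * (measure lborel (dcube j k :: (real^'n) set)) powr (s / real CARD('n) + 1/2)}"

definition T_set :: "int \<Rightarrow> real \<Rightarrow> (nat \<Rightarrow> real^'n \<Rightarrow> real) \<Rightarrow> (real^'n::finite \<Rightarrow> real) \<Rightarrow> real
     \<Rightarrow> ((real^'n) \<times> real) set" where
  "T_set j s \<psi> f \<epsilon> = (\<Union>k\<in>W_set j s \<psi> f \<epsilon>. Tbox j k)"

definition hyp_dist :: "((real^'n) \<times> real) \<Rightarrow> ((real^'n) \<times> real) \<Rightarrow> real" where
  "hyp_dist p q = arcosh (1 + ((norm (fst p - fst q))^2 + (snd p - snd q)^2)
                              / (2 * snd p * snd q))"

definition hyp_nbhd :: "((real^'n) \<times> real) set \<Rightarrow> real \<Rightarrow> ((real^'n) \<times> real) set" where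
  "hyp_nbhd A R = {p. 0 < snd p \<and> (\<exists>q\<in>A. hyp_dist p q < R)}"

end

theory Submission
  imports Defs "HOL-Computational_Algebra.Polynomial"
begin

text \<open>After rescaling the cube to unit size, a wavelet coefficient becomes \<open>\<integral> g \<psi>\<close> with \<open>\<psi>\<close>
  compactly supported and orthogonal to polynomials of degree below \<open>r\<close>. A Whitney type
  inequality bounds the distance of \<open>g\<close> to such polynomials on a ball by the size \<open>M\<close> of the
  differences \<open>\<Delta>\<^sub>h\<^sup>r g\<close> with \<open>1/(4r) \<le> |h| \<le> 1/2\<close> on a larger ball, hence also the
  coefficient by a multiple of \<open>M\<close>. A large coefficient therefore forces a large difference at
  comparable scale and location, i.e. at bounded hyperbolic distance.\<close>

text \<open>Finitely many layers starting at j+1 control only differences whose rescaled step lies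
  in a window bounded away from 0, so the Whitney inequality must work without information on small
  steps. On the line it does: approximating \<open>g\<close> uses one step in [1/4, 1/2], and
  bounding the r-th derivative of the approximant uses the steps k/(4r), k = 1, ..., r. These two
  ranges give the window.

  The polynomial found on a line is not canonical, so those of parallel lines need not fit together.
  It is exchanged for Lagrange interpolation at 0, ..., r-1, a fixed linear operation that can be
  iterated over the coordinates.

  The comparison of scales is argued by contradiction: a point outside all neighbourhoods forces
  every difference in the window near it to be at most c eps a^s, with a the side length of the
  cube, and then no coefficient of that cube exceeds the threshold.\<close>

subsection \<open>Forward differences\<close>

text \<open>This is (-1)^r times the usual forward difference: \<open>g x\<close> enters with
  coefficient +1 and can be solved for.\<close>

primrec fdiff :: "nat \<Rightarrow> ('a::real_vector \<Rightarrow> real) \<Rightarrow> 'a \<Rightarrow> 'a \<Rightarrow> real" where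
  "fdiff 0 g h x = g x"
| "fdiff (Suc r) g h x = fdiff r g h x - fdiff r g h (x + h)"

lemma fdiff_add: "fdiff r (\<lambda>x. f x + g x) h x = fdiff r f h x + fdiff r g h x"
  by (induction r arbitrary: x) auto

lemma fdiff_cmult: "fdiff r (\<lambda>x. c * f x) h x = c * fdiff r f h x"
  by (induction r arbitrary: x) (auto simp: algebra_simps)

lemma fdiff_sum: "fdiff r (\<lambda>x. \<Sum>k\<in>A. f k x) h x = (\<Sum>k\<in>A. fdiff r (f k) h x)"
  by (induction r arbitrary: x) (auto simp: sum_subtractf)

lemma fdiff_linear_comp:
  assumes "linear T"
  shows "fdiff r (\<lambda>x. f (p + T x)) h x = fdiff r f (T h) (p + T x)"
  by (induction r arbitrary: x) (auto simp: linear_add[OF assms] add.assoc)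

lemma fdiff_diff_commute:
  "fdiff r (\<lambda>x. f x - f (x + h)) h x = fdiff r f h x - fdiff r f h (x + h)"
  by (induction r arbitrary: x) auto

lemma fdiff_eq_sum:
  "fdiff r g h x = (\<Sum>k\<le>r. (-1) ^ k * real (r choose k) * g (x + real k *\<^sub>R h))"
proof (induction r arbitrary: x)
  case (Suc r)
  let ?G = "\<lambda>k. g (x + real k *\<^sub>R h)"
  have "(\<Sum>k\<le>Suc r. (-1) ^ k * real (Suc r choose k) * ?G k)
      = g x + (\<Sum>k\<le>r. (-1) ^ Suc k * real (Suc r choose Suc k) * ?G (Suc k))"
    by (subst sum.atMost_Suc_shift) simp
  also have "\<dots> = g x + (\<Sum>k\<le>r. (-1) ^ Suc k * real (r choose Suc k) * ?G (Suc k))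
       + (\<Sum>k\<le>r. (-1) ^ Suc k * real (r choose k) * ?G (Suc k))"
    by (simp add: sum.distrib[symmetric] algebra_simps sum_negf[symmetric] del: sum_negf)
  also have "g x + (\<Sum>k\<le>r. (-1) ^ Suc k * real (r choose Suc k) * ?G (Suc k))
       = (\<Sum>k\<le>Suc r. (-1) ^ k * real (r choose k) * ?G k)"
    by (subst sum.atMost_Suc_shift) simp
  also have "\<dots> = (\<Sum>k\<le>r. (-1) ^ k * real (r choose k) * ?G k)"
    by simp
  also have "(\<Sum>k\<le>r. (-1) ^ Suc k * real (r choose k) * ?G (Suc k))
       = - (\<Sum>k\<le>r. (-1) ^ k * real (r choose k) * g (x + h + real k *\<^sub>R h))"
    by (simp add: sum_negf[symmetric] algebra_simps del: sum_negf)
  finally show ?case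
    by (simp add: Suc.IH)
qed simp

text \<open>Induction applies the claim to the first differences \<open>d i\<close>, then one
  ordinary mean value step finishes. The unknown point \<open>\<xi>\<close> takes the place of
  integration against a B-spline.\<close>

lemma fdiff_mean_value:
  fixes e :: "nat \<Rightarrow> real \<Rightarrow> real"
  assumes "\<And>i t. i < r \<Longrightarrow> (e i has_real_derivative e (Suc i) t) (at t)" and "0 < \<eta>"
  shows "\<exists>\<xi>. a \<le> \<xi> \<and> \<xi> \<le> a + real r * \<eta> \<and> fdiff r (e 0) \<eta> a = (-\<eta>) ^ r * e r \<xi>"
  using assms(1)
proof (induction r arbitrary: e)
  case (Suc r)
  define d where "d = (\<lambda>i t. e i t - e i (t + \<eta>))"
  have "(d i has_real_derivative d (Suc i) t) (at t)" if "i < r" for i t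
  proof -
    have *: "(e i has_real_derivative e (Suc i) u) (at u)" for u
      using Suc.prems that by auto
    show ?thesis unfolding d_def
      by (rule DERIV_diff[OF * ]) (use DERIV_shift[of "e i" _ t \<eta>] * in auto)
  qed
  from Suc.IH[of d, OF this] obtain \<xi> where \<xi>: "a \<le> \<xi>" "\<xi> \<le> a + real r * \<eta>"
    "fdiff r (d 0) \<eta> a = (-\<eta>) ^ r * d r \<xi>" by blast
  have "\<exists>z. z > \<xi> \<and> z < \<xi> + \<eta> \<and> e r (\<xi> + \<eta>) - e r \<xi> = (\<xi> + \<eta> - \<xi>) * e (Suc r) z"
    by (rule MVT2) (use Suc.prems \<open>0 < \<eta>\<close> in auto)
  then obtain z where z: "z > \<xi>" "z < \<xi> + \<eta>" "e r (\<xi> + \<eta>) - e r \<xi> = \<eta> * e (Suc r) z"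
    by auto
  have "fdiff (Suc r) (e 0) \<eta> a = fdiff r (d 0) \<eta> a"
    by (simp add: d_def fdiff_diff_commute)
  also have "\<dots> = (-\<eta>) ^ r * (e r \<xi> - e r (\<xi> + \<eta>))"
    using \<xi>(3) by (simp add: d_def)
  also have "e r \<xi> - e r (\<xi> + \<eta>) = - \<eta> * e (Suc r) z"
    using z(3) by (simp add: algebra_simps)
  finally have "fdiff (Suc r) (e 0) \<eta> a = (-\<eta>) ^ Suc r * e (Suc r) z"
    by (simp add: algebra_simps)
  moreover have "a \<le> z" "z \<le> a + real (Suc r) * \<eta>"
    using z \<xi> by (auto simp: algebra_simps)
  ultimately show ?case by blast
qed auto

lemma continuous_antiderivative:
  fixes f :: "real \<Rightarrow> real"
  assumes "continuous_on UNIV f"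
  shows "\<exists>F. \<forall>x. (F has_real_derivative f x) (at x)"
proof -
  have "\<exists>F. \<forall>x :: real. (-\<infinity>::ereal) < ereal x \<longrightarrow> ereal x < \<infinity>
      \<longrightarrow> (F has_vector_derivative f x) (at x)"
    using assms by (intro einterval_antiderivative) (auto simp: continuous_on_eq_continuous_at)
  then show ?thesis
    by (auto simp: has_real_derivative_iff_has_vector_derivative)
qed

lemma iterated_antiderivatives:
  fixes g :: "real \<Rightarrow> real"
  assumes "continuous_on UNIV g"
  shows "\<exists>F. F 0 = g \<and> (\<forall>i t. (F (Suc i) has_real_derivative F i t) (at t))"
proof -
  \<comment> \<open>Continuity is carried along because the next antiderivative needs it; the clause
    for \<open>i = 0\<close> pins the start to \<open>g\<close>.\<close>
  have "\<exists>F. \<forall>i. (continuous_on UNIV (F i) \<and> (i = 0 \<longrightarrow> F i = g))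
      \<and> (\<forall>t. (F (Suc i) has_real_derivative F i t) (at t))"
  proof (rule dependent_nat_choice)
    show "\<exists>G. continuous_on UNIV G \<and> ((0::nat) = 0 \<longrightarrow> G = g)"
      using assms by auto
    fix x :: "real \<Rightarrow> real" and n :: nat
    assume "continuous_on UNIV x \<and> (n = 0 \<longrightarrow> x = g)"
    then obtain y where y: "\<forall>t. (y has_real_derivative x t) (at t)"
      using continuous_antiderivative by blast
    then have "continuous_on UNIV y"
      by (meson DERIV_isCont continuous_at_imp_continuous_on)
    with y show "\<exists>y. (continuous_on UNIV y \<and> (Suc n = 0 \<longrightarrow> y = g)) \<and>
           (\<forall>t. (y has_real_derivative x t) (at t))"
      by blast
  qed
  then show ?thesis by blast
qed

subsection \<open>Whitney inequality and Lagrange interpolation on the line\<close>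

lemma fdiff_has_real_derivative:
  assumes "\<And>t. (F has_real_derivative F' t) (at t)"
  shows "((\<lambda>t. fdiff r F h (t + c)) has_real_derivative fdiff r F' h (t + c)) (at t)"
proof (induction r arbitrary: c)
  case 0
  show ?case using assms[of "t + c"] by (simp add: DERIV_shift)
next
  case (Suc r)
  show ?case
    using DERIV_diff[OF Suc.IH[of c] Suc.IH[of "c + h"]] by (simp add: add.assoc)
qed

lemma fdiff_scaled_argument:
  fixes F :: "real \<Rightarrow> real"
  shows "fdiff r (\<lambda>t. F (x + k * t)) h a = fdiff r F (k * h) (x + k * a)"
proof -
  have "linear (\<lambda>t::real. k * t)"
    by (simp add: linear_iff algebra_simps)
  from fdiff_linear_comp[OF this] show ?thesis .
qed

text \<open>The r-th derivative of t^r/r! is the constant 1, so the unknown mean value point drops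
  out.\<close>

lemma fdiff_power_over_fact:
  assumes "0 < (\<eta>::real)"
  shows "fdiff r (\<lambda>t. t ^ r / fact r) \<eta> a = (-\<eta>) ^ r"
proof -
  define e where "e = (\<lambda>i t::real. t ^ (r - i) / fact (r - i))"
  have "(e i has_real_derivative e (Suc i) t) (at t)" if "i < r" for i t
  proof -
    obtain m where m: "r - i = Suc m" "r - Suc i = m"
      using Suc_diff_Suc[OF \<open>i < r\<close>] by metis
    have "((\<lambda>t::real. t ^ Suc m / fact (Suc m)) has_real_derivative t ^ m / fact m) (at t)"
      by (auto intro!: derivative_eq_intros simp: field_simps simp del: power_Suc of_nat_Suc)
    then show ?thesis by (simp add: e_def m del: fact_Suc)
  qed
  from fdiff_mean_value[of r e \<eta> a, OF this assms]
  show ?thesis by (auto simp: e_def)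
qed

text \<open>With \<open>F\<close> an \<open>r\<close>-fold antiderivative of \<open>g\<close>, averaging the identity
  \<open>g x = fdiff r g h x - (\<Sum>k=1..r. \<dots> g (x + k h))\<close> over \<open>h\<close> against a B-spline replaces
  each \<open>g (x + k h)\<close> by an \<open>r\<close>-th difference of \<open>F\<close>. Hence \<open>g\<close> is, up to \<open>M\<close>, a
  function whose \<open>r\<close>-th derivative is again a combination of \<open>r\<close>-th differences of \<open>g\<close>,
  and the polynomial is its Taylor polynomial.\<close>
lemma whitney_real:
  fixes g :: "real \<Rightarrow> real"
  assumes g: "continuous_on UNIV g" and r: "1 \<le> r" and M: "0 \<le> M" and "0 \<le> b"
    and bound: "\<And>x h. \<bar>x\<bar> \<le> b + real r \<Longrightarrow> 1 / (4 * real r) \<le> h \<Longrightarrow> h \<le> 1/2 \<Longrightarrow>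
        \<bar>fdiff r g h x\<bar> \<le> M"
  shows "\<exists>Q. degree Q < r \<and>
     (\<forall>t. \<bar>t\<bar> \<le> b \<longrightarrow> \<bar>g t - poly Q t\<bar> \<le> (1 + (8 * real r * b) ^ r) * M)"
proof -
  \<comment> \<open>With r eta = 1/4, mean value points between 1/4 and 1/4 + r eta stay in
    [1/4, 1/2], and the steps k eta stay in [1/(4r), 1/4].\<close>
  define \<eta> where "\<eta> = 1 / (4 * real r)"
  have \<eta>: "0 < \<eta>" "real r * \<eta> = 1/4" using r by (auto simp: \<eta>_def)
  obtain F where F0: "F 0 = g" and F: "\<And>i t. (F (Suc i) has_real_derivative F i t) (at t)"
    using iterated_antiderivatives[OF g] by blast
  have Fd: "(F (r - i) has_real_derivative F (r - Suc i) t) (at t)" if "i < r" for i t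
    using F[of "r - Suc i" t] that by (simp add: Suc_diff_Suc)
  \<comment> \<open>Differentiating F (x + k t) r times in t yields k^r; the division cancels it and
    leaves the weights of \<open>fdiff\<close>.\<close>
  define w where "w = (\<lambda>k. (-1) ^ k * real (r choose k) / real k ^ r)"
  \<comment> \<open>\<open>G 0\<close> is the part k \<ge> 1 of the averaged identity, solved for
    \<open>g x\<close>. The \<open>G i\<close> are its successive derivatives, and
    \<open>G r\<close> involves only differences of \<open>F 0 = g\<close>.\<close>
  define G where "G = (\<lambda>i x. - (1 / (-\<eta>) ^ r) *
     (\<Sum>k=1..r. w k * fdiff r (F (r - i)) (real k * \<eta>) (x + real k * (1/4))))"
  have G_deriv: "(G i has_real_derivative G (Suc i) t) (at t)" if "i < r" for i t
    unfolding G_def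
    by (rule DERIV_cmult, rule DERIV_sum, rule DERIV_cmult,
        rule fdiff_has_real_derivative, rule Fd[OF that])
  have G_approx: "\<bar>g x - G 0 x\<bar> \<le> M" if x: "\<bar>x\<bar> \<le> b" for x
  proof -
    \<comment> \<open>A chain of derivatives in the step t with x fixed, built so that
      \<open>e r t\<close> is \<open>fdiff r g t x\<close>.\<close>
    define e where "e = (\<lambda>i t. g x * (t ^ (r - i) / fact (r - i)) +
       (\<Sum>k=1..r. (w k * real k ^ i) * F (r - i) (x + real k * t)))"
    have e_deriv: "(e i has_real_derivative e (Suc i) t) (at t)" if "i < r" for i t
    proof -
      obtain m where m: "r - i = Suc m" "r - Suc i = m"
        using Suc_diff_Suc[OF \<open>i < r\<close>] by metis
      have 1: "((\<lambda>t::real. t ^ Suc m / fact (Suc m)) has_real_derivative t ^ m / fact m) (at t)"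
        by (auto intro!: derivative_eq_intros simp: field_simps simp del: power_Suc of_nat_Suc)
      have 2: "((\<lambda>t. F (Suc m) (x + real k * t)) has_real_derivative
          F m (x + real k * t) * real k) (at t)" for k
        by (rule DERIV_chain2[OF F]) (auto intro!: derivative_eq_intros)
      have "(e i has_real_derivative g x * (t ^ m / fact m) +
         (\<Sum>k=1..r. (w k * real k ^ i) * (F m (x + real k * t) * real k))) (at t)"
        unfolding e_def m
        by (rule DERIV_add, rule DERIV_cmult, rule 1, rule DERIV_sum, rule DERIV_cmult, rule 2)
      then show ?thesis
        by (simp add: e_def m mult_ac)
    qed
    have e_r: "e r h = fdiff r g h x" for h
    proof -
      have "(\<Sum>k=1..r. (w k * real k ^ r) * g (x + real k * h))
          = (\<Sum>k=1..r. (-1) ^ k * real (r choose k) * g (x + real k * h))"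
        by (intro sum.cong) (auto simp: w_def)
      moreover have "{..r} = insert 0 {1..r}" by auto
      ultimately show ?thesis
        by (simp add: e_def fdiff_eq_sum F0)
    qed
    \<comment> \<open>Evaluating \<open>fdiff r (e 0)\<close> both by the mean value form and
      termwise identifies \<open>g x - G 0 x\<close> with a single difference of \<open>g\<close> of
      step \<open>\<xi>\<close>.\<close>
    obtain \<xi> where \<xi>: "1/4 \<le> \<xi>" "\<xi> \<le> 1/4 + real r * \<eta>"
        "fdiff r (e 0) \<eta> (1/4) = (-\<eta>) ^ r * e r \<xi>"
      using fdiff_mean_value[of r e \<eta> "1/4", OF e_deriv \<eta>(1)] by blast
    have "fdiff r (e 0) \<eta> (1/4) = g x * (-\<eta>) ^ r +
       (\<Sum>k=1..r. w k * fdiff r (F r) (real k * \<eta>) (x + real k * (1/4)))"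
      by (simp add: e_def fdiff_add fdiff_sum fdiff_cmult fdiff_scaled_argument
           fdiff_power_over_fact[OF \<eta>(1), simplified] del: times_divide_eq_right)
    moreover have "(-\<eta>) ^ r * G 0 x =
       - (\<Sum>k=1..r. w k * fdiff r (F r) (real k * \<eta>) (x + real k * (1/4)))"
      using \<eta>(1) by (simp add: G_def)
    ultimately have "(-\<eta>) ^ r * (g x - G 0 x) = (-\<eta>) ^ r * e r \<xi>"
      using \<xi>(3) by (simp add: algebra_simps)
    then have "g x - G 0 x = fdiff r g \<xi> x"
      using \<eta>(1) by (simp add: e_r)
    moreover have "1 / (4 * real r) \<le> 1 / 4"
      using r by (simp add: field_simps)
    then have "1 / (4 * real r) \<le> \<xi>" using \<xi>(1) by linarith
    ultimately show ?thesis
      using bound[of x \<xi>] \<xi> x \<eta>(2) r by simp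
  qed
  have G_r: "\<bar>G r x\<bar> \<le> (8 * real r) ^ r * M" if x: "\<bar>x\<bar> \<le> b" for x
  proof -
    have fd: "\<bar>w k * fdiff r g (real k * \<eta>) (x + real k * (1/4))\<bar> \<le> real (r choose k) * M"
      if k: "k \<in> {1..r}" for k
    proof -
      have "real k * \<eta> \<le> real r * \<eta>" "1 * \<eta> \<le> real k * \<eta>"
        using k \<eta>(1) by (auto intro!: mult_right_mono)
      then have "\<bar>fdiff r g (real k * \<eta>) (x + real k * (1/4))\<bar> \<le> M"
        using x k \<eta> by (intro bound) (auto simp: \<eta>_def)
      moreover have "\<bar>w k\<bar> \<le> real (r choose k)"
        using k by (auto simp: w_def abs_mult power_abs field_simps mult_le_cancel_left1)
      ultimately show ?thesis
        unfolding abs_mult by (intro mult_mono) auto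
    qed
    have "\<bar>\<Sum>k=1..r. w k * fdiff r g (real k * \<eta>) (x + real k * (1/4))\<bar>
        \<le> (\<Sum>k=1..r. real (r choose k) * M)"
      by (rule order_trans[OF sum_abs sum_mono[OF fd]])
    also have "\<dots> \<le> (\<Sum>k\<le>r. real (r choose k) * M)"
      using M by (intro sum_mono2) auto
    also have "\<dots> = 2 ^ r * M"
      using choose_row_sum[of r] by (simp flip: sum_distrib_right of_nat_sum)
    finally have *: "\<bar>\<Sum>k=1..r. w k * fdiff r g (real k * \<eta>) (x + real k * (1/4))\<bar> \<le> 2 ^ r * M" .
    have "\<bar>G r x\<bar> = (4 * real r) ^ r * \<bar>\<Sum>k=1..r. w k * fdiff r g (real k * \<eta>) (x + real k * (1/4))\<bar>"
      using r by (simp add: G_def F0 abs_mult power_abs) (simp add: \<eta>_def power_divide)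
    also have "\<dots> \<le> (4 * real r) ^ r * (2 ^ r * M)"
      using * by (intro mult_left_mono) auto
    also have "\<dots> = (8 * real r) ^ r * M"
      unfolding mult.assoc[symmetric] power_mult_distrib[symmetric] by simp
    finally show ?thesis .
  qed
  define Q where "Q = (\<Sum>i<r. Polynomial.monom (G i 0 / fact i) i)"
  have "degree Q < r"
    unfolding Q_def using r
    by (intro degree_sum_less) (auto intro: le_less_trans[OF degree_monom_le])
  moreover have "\<bar>g t - poly Q t\<bar> \<le> (1 + (8 * real r * b) ^ r) * M" if t: "\<bar>t\<bar> \<le> b" for t
  proof -
    obtain u where u: "\<bar>u\<bar> \<le> \<bar>t\<bar>"
      "G 0 t = (\<Sum>m<r. G m 0 / fact m * t ^ m) + G r u / fact r * t ^ r"
      using Maclaurin_bi_le[of G "G 0" r t] G_deriv by auto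
    have "\<bar>G 0 t - poly Q t\<bar> = \<bar>G r u\<bar> / fact r * \<bar>t\<bar> ^ r"
      by (simp add: u(2) Q_def poly_sum poly_monom abs_mult power_abs)
    also have "\<dots> \<le> ((8 * real r) ^ r * M) / 1 * b ^ r"
      using u t M G_r[of u] \<open>0 \<le> b\<close> by (intro mult_mono frac_le power_mono) (auto simp: fact_ge_1)
    finally show ?thesis
      using G_approx[OF t] by (simp add: power_mult_distrib algebra_simps)
  qed
  ultimately show ?thesis by blast
qed

section \<open>Lagrange interpolation at the nodes 0, ..., r-1\<close>

definition lagrange_basis :: "nat \<Rightarrow> nat \<Rightarrow> real poly" where
  "lagrange_basis r k = (\<Prod>i\<in>{..<r} - {k}. smult (1 / (real k - real i)) [:- real i, 1:])"

lemma poly_lagrange_basis: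
  assumes "k < r" "j < r"
  shows "poly (lagrange_basis r k) (real j) = (if j = k then 1 else 0)"
proof (cases "j = k")
  case True
  have "(\<Prod>i\<in>{..<r} - {k}. (real k - real i) / (real k - real i)) = 1"
    by (intro prod.neutral) auto
  with True show ?thesis
    unfolding lagrange_basis_def poly_prod by (simp add: diff_divide_distrib[symmetric])
next
  case False
  with assms show ?thesis
    by (auto simp: lagrange_basis_def poly_prod prod_zero_iff)
qed

lemma degree_lagrange_basis:
  assumes "k < r"
  shows "degree (lagrange_basis r k) < r"
proof -
  have "degree (lagrange_basis r k) \<le> (\<Sum>i\<in>{..<r} - {k}. 1)"
    unfolding lagrange_basis_def
    by (rule order_trans[OF degree_prod_sum_le]) (auto intro!: sum_mono)
  also have "\<dots> = r - 1" using assms by simp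
  finally show ?thesis using assms by simp
qed

lemma lagrange_interpolation:
  assumes "degree Q < r"
  shows "Q = (\<Sum>k<r. smult (poly Q (real k)) (lagrange_basis r k))" (is "_ = ?R")
proof (rule poly_eqI_degree[of "real ` {..<r}"])
  show "degree Q < card (real ` {..<r})" "degree ?R < card (real ` {..<r})"
    using assms by (auto simp: card_image intro!: degree_sum_less degree_lagrange_basis
        le_less_trans[OF degree_smult_le])
  fix x assume "x \<in> real ` {..<r}"
  then obtain j where j: "x = real j" "j < r" by auto
  have "poly ?R x = (\<Sum>k<r. poly Q (real k) * (if j = k then 1 else 0))"
    unfolding poly_sum poly_smult using j
    by (intro sum.cong) (auto simp: poly_lagrange_basis)
  also have "\<dots> = poly Q x" using j by (simp add: if_distrib cong: if_cong)
  finally show "poly Q x = poly ?R x" ..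
qed

lemma lagrange_basis_bounded:
  "\<exists>B\<ge>0. \<forall>k<r. \<forall>t. \<bar>t\<bar> \<le> b \<longrightarrow> \<bar>poly (lagrange_basis r k) t\<bar> \<le> B"
proof -
  have "\<exists>B\<ge>0. \<forall>t. \<bar>t\<bar> \<le> b \<longrightarrow> \<bar>poly (lagrange_basis r k) t\<bar> \<le> B" for k
  proof -
    have "compact (poly (lagrange_basis r k) ` {-b..b})"
      by (intro compact_continuous_image continuous_intros) auto
    then have "bounded (poly (lagrange_basis r k) ` {-b..b})" by (rule compact_imp_bounded)
    then obtain B where "B > 0" "\<And>t. t \<in> {-b..b} \<Longrightarrow> \<bar>poly (lagrange_basis r k) t\<bar> \<le> B"
      by (auto simp: bounded_pos)
    then show ?thesis by (intro exI[of _ B]) (auto simp: abs_le_iff)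
  qed
  then obtain B where B: "\<And>k. B k \<ge> 0" "\<And>k t. \<bar>t\<bar> \<le> b \<Longrightarrow> \<bar>poly (lagrange_basis r k) t\<bar> \<le> B k"
    by metis
  have "B k \<le> (\<Sum>k<r. B k)" if "k < r" for k
    using that B(1) by (intro member_le_sum) auto
  then have "\<forall>k<r. \<forall>t. \<bar>t\<bar> \<le> b \<longrightarrow> \<bar>poly (lagrange_basis r k) t\<bar> \<le> (\<Sum>k<r. B k)"
    using B(2) order_trans by blast
  moreover have "0 \<le> (\<Sum>k<r. B k)"
    using B(1) by (simp add: sum_nonneg)
  ultimately show ?thesis by blast
qed

text \<open>Coefficients are fixed linear combinations of the values at 0, ..., N-1. This will turn
  closeness at finitely many points into smallness of homogeneous parts.\<close>

lemma lagrange_coeff_bounded: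
  "\<exists>B\<ge>0. \<forall>p K. degree p < N \<longrightarrow> (\<forall>k<N. \<bar>poly p (real k)\<bar> \<le> K) \<longrightarrow> (\<forall>d<N. \<bar>coeff p d\<bar> \<le> B * K)"
proof -
  define B where "B = (\<Sum>k<N. \<Sum>d<N. \<bar>coeff (lagrange_basis N k) d\<bar>)"
  have "\<bar>coeff p d\<bar> \<le> B * K"
    if p: "degree p < N" and K: "\<forall>k<N. \<bar>poly p (real k)\<bar> \<le> K" and d: "d < N" for p K d
  proof -
    have "0 \<le> K" using K d by force
    have "coeff p d = (\<Sum>k<N. poly p (real k) * coeff (lagrange_basis N k) d)"
      by (subst lagrange_interpolation[OF p]) (simp add: coeff_sum)
    also have "\<bar>\<dots>\<bar> \<le> (\<Sum>k<N. K * (\<Sum>d<N. \<bar>coeff (lagrange_basis N k) d\<bar>))"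
      unfolding abs_mult using K d \<open>0 \<le> K\<close>
      by (intro order_trans[OF sum_abs] sum_mono) (auto simp: abs_mult intro!: mult_mono member_le_sum)
    finally show ?thesis by (simp add: B_def sum_distrib_left[symmetric] mult.commute)
  qed
  moreover have "B \<ge> 0" by (auto simp: B_def intro!: sum_nonneg)
  ultimately show ?thesis by blast
qed

text \<open>Interpolation reproduces the Whitney polynomial Q, so the error for g is that for g - Q,
  which is small at t and at the nodes; \<open>real r \<le> b\<close> keeps the nodes in the
  interval.\<close>

lemma lagrange_interpolation_error:
  assumes "1 \<le> r" "real r \<le> b"
  shows "\<exists>C\<ge>0. \<forall>g M. continuous_on UNIV g \<longrightarrow> 0 \<le> M \<longrightarrow>
     (\<forall>x h. \<bar>x\<bar> \<le> b + real r \<longrightarrow> 1 / (4 * real r) \<le> h \<longrightarrow> h \<le> 1/2 \<longrightarrow> \<bar>fdiff r g h x\<bar> \<le> M) \<longrightarrow>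
     (\<forall>t. \<bar>t\<bar> \<le> b \<longrightarrow> \<bar>g t - (\<Sum>k<r. poly (lagrange_basis r k) t * g (real k))\<bar> \<le> C * M)"
proof -
  obtain B where B: "B \<ge> 0" "\<And>k t. k < r \<Longrightarrow> \<bar>t\<bar> \<le> b \<Longrightarrow> \<bar>poly (lagrange_basis r k) t\<bar> \<le> B"
    using lagrange_basis_bounded[of r b] by blast
  define W where "W = 1 + (8 * real r * b) ^ r"
  have W: "W \<ge> 0" using assms by (simp add: W_def)
  have "\<bar>g t - (\<Sum>k<r. poly (lagrange_basis r k) t * g (real k))\<bar> \<le> (W + real r * B * W) * M"
    if g: "continuous_on UNIV g" "0 \<le> M"
      "\<forall>x h. \<bar>x\<bar> \<le> b + real r \<longrightarrow> 1 / (4 * real r) \<le> h \<longrightarrow> h \<le> 1/2 \<longrightarrow> \<bar>fdiff r g h x\<bar> \<le> M"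
      and t: "\<bar>t\<bar> \<le> b" for g M t
  proof -
    obtain Q where Q: "degree Q < r" "\<And>t. \<bar>t\<bar> \<le> b \<Longrightarrow> \<bar>g t - poly Q t\<bar> \<le> W * M"
      using whitney_real[OF g(1) assms(1) g(2), of b] g(3) assms unfolding W_def by auto
    have "poly Q t = (\<Sum>k<r. poly (lagrange_basis r k) t * poly Q (real k))"
      by (subst lagrange_interpolation[OF Q(1)]) (simp add: poly_sum mult.commute)
    then have "g t - (\<Sum>k<r. poly (lagrange_basis r k) t * g (real k))
       = (g t - poly Q t) - (\<Sum>k<r. poly (lagrange_basis r k) t * (g (real k) - poly Q (real k)))"
      by (simp add: right_diff_distrib sum_subtractf)
    moreover have "\<bar>\<Sum>k<r. poly (lagrange_basis r k) t * (g (real k) - poly Q (real k))\<bar>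
        \<le> (\<Sum>k<r. B * (W * M))"
      using B t Q(2) assms by (intro order_trans[OF sum_abs] sum_mono) (auto simp: abs_mult intro!: mult_mono)
    ultimately show ?thesis
      using Q(2)[OF t] by (simp add: algebra_simps)
  qed
  then show ?thesis
    using B(1) W by (intro exI[of _ "W + real r * B * W"]) auto
qed

subsection \<open>Whitney inequality in several variables\<close>

text \<open>Only the base point is confined to the ball, the other points of the difference may
  leave it. The step window is preserved by restriction to lines with unit direction.\<close>

definition diff_bounded :: "nat \<Rightarrow> real \<Rightarrow> real \<Rightarrow> ('a::real_normed_vector \<Rightarrow> real) \<Rightarrow> bool" where
  "diff_bounded r \<rho> M f \<longleftrightarrow> (\<forall>x v. norm x \<le> \<rho> \<longrightarrow> 1 / (4 * real r) \<le> norm v \<longrightarrow>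
      norm v \<le> 1/2 \<longrightarrow> \<bar>fdiff r f v x\<bar> \<le> M)"

lemma diff_bounded_line:
  assumes "diff_bounded r \<rho> M f" "norm u = 1" "norm p + b + real r \<le> \<rho>" "1 \<le> r"
    and "\<bar>x\<bar> \<le> b + real r" "1 / (4 * real r) \<le> h" "h \<le> 1/2"
  shows "\<bar>fdiff r (\<lambda>t. f (p + t *\<^sub>R u)) h x\<bar> \<le> M"
proof -
  have "linear (\<lambda>t::real. t *\<^sub>R u)"
    by (simp add: linear_iff algebra_simps)
  then have "fdiff r (\<lambda>t. f (p + t *\<^sub>R u)) h x = fdiff r f (h *\<^sub>R u) (p + x *\<^sub>R u)"
    by (rule fdiff_linear_comp)
  moreover have "norm (p + x *\<^sub>R u) \<le> \<rho>"
    using norm_triangle_ineq[of p "x *\<^sub>R u"] assms by simp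
  moreover have "0 < 1 / (4 * real r)" using assms by simp
  then have "0 < h" using assms by linarith
  then have "norm (h *\<^sub>R u) = h" using assms by simp
  ultimately show ?thesis
    using assms unfolding diff_bounded_def by metis
qed

text \<open>Coordinates outside \<open>A\<close> stay free, so that induction over \<open>A\<close>
  can reach \<open>UNIV\<close>. \<open>PiE\<close> makes each choice of nodes on \<open>A\<close>
  count once.\<close>

definition tensor_interp :: "nat \<Rightarrow> 'n::finite set \<Rightarrow> (real^'n \<Rightarrow> real) \<Rightarrow> real^'n \<Rightarrow> real" where
  "tensor_interp r A f x = (\<Sum>k\<in>PiE A (\<lambda>_. {..<r}).
      (\<Prod>i\<in>A. poly (lagrange_basis r (k i)) (x $ i)) *
      f (\<chi> i. if i \<in> A then real (k i) else x $ i))"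

text \<open>Isolates the one-dimensional interpolation in direction \<open>a\<close>: coordinate
  \<open>a\<close> of the base point is set to 0, so the inner sum runs along a line parametrised by
  that coordinate.\<close>

lemma tensor_interp_insert:
  fixes A :: "'n::finite set"
  assumes "a \<notin> A"
  shows "tensor_interp r (insert a A) f x = (\<Sum>k\<in>PiE A (\<lambda>_. {..<r}).
      (\<Prod>i\<in>A. poly (lagrange_basis r (k i)) (x $ i)) *
      (\<Sum>j<r. poly (lagrange_basis r j) (x $ a) *
         f ((\<chi> i. if i \<in> A then real (k i) else if i = a then 0 else x $ i) + real j *\<^sub>R axis a 1)))"
proof -
  let ?S = "{..<r} \<times> PiE A (\<lambda>_. {..<r})"
  let ?c = "\<lambda>(j, k). k(a := j)"
  define t where "t k = (\<Prod>i\<in>insert a A. poly (lagrange_basis r (k i)) (x $ i)) *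
      f (\<chi> i. if i \<in> insert a A then real (k i) else x $ i)" for k :: "'n \<Rightarrow> nat"
  have "tensor_interp r (insert a A) f x = sum t (?c ` ?S)"
    unfolding tensor_interp_def t_def PiE_insert_eq ..
  also have "\<dots> = (\<Sum>jk\<in>?S. t (?c jk))"
    using inj_combinator[OF assms, of "\<lambda>_. {..<r}"] by (subst sum.reindex) auto
  also have "\<dots> = (\<Sum>(j, k)\<in>?S. t (k(a := j)))"
    by (simp add: case_prod_unfold)
  also have "\<dots> = (\<Sum>j<r. \<Sum>k\<in>PiE A (\<lambda>_. {..<r}). t (k(a := j)))"
    by (rule sum.cartesian_product[symmetric])
  also have "\<dots> = (\<Sum>k\<in>PiE A (\<lambda>_. {..<r}). \<Sum>j<r. t (k(a := j)))"
    by (rule sum.swap)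
  also have "\<dots> = (\<Sum>k\<in>PiE A (\<lambda>_. {..<r}).
      (\<Prod>i\<in>A. poly (lagrange_basis r (k i)) (x $ i)) *
      (\<Sum>j<r. poly (lagrange_basis r j) (x $ a) *
         f ((\<chi> i. if i \<in> A then real (k i) else if i = a then 0 else x $ i) + real j *\<^sub>R axis a 1)))"
  proof -
    have "t (k(a := j)) = (\<Prod>i\<in>A. poly (lagrange_basis r (k i)) (x $ i)) *
      (poly (lagrange_basis r j) (x $ a) *
         f ((\<chi> i. if i \<in> A then real (k i) else if i = a then 0 else x $ i) + real j *\<^sub>R axis a 1))"
      for j k
    proof -
      have "(\<Prod>i\<in>A. poly (lagrange_basis r ((k(a := j)) i)) (x $ i))
          = (\<Prod>i\<in>A. poly (lagrange_basis r (k i)) (x $ i))"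
        using assms by (intro prod.cong) auto
      moreover have "(\<chi> i. if i \<in> insert a A then real ((k(a := j)) i) else x $ i)
         = (\<chi> i. if i \<in> A then real (k i) else if i = a then 0 else x $ i) + real j *\<^sub>R axis a 1"
        using assms by (auto simp: vec_eq_iff axis_def)
      ultimately show ?thesis
        using assms unfolding t_def by (subst prod.insert) auto
    qed
    then show ?thesis by (simp add: sum_distrib_left)
  qed
  finally show ?thesis .
qed

lemma norm_le_card_mult:
  fixes x :: "real^'n::finite"
  assumes "\<And>i. \<bar>x $ i\<bar> \<le> b"
  shows "norm x \<le> real CARD('n) * b"
  using norm_le_l1_cart[of x] sum_mono[of UNIV "\<lambda>i. \<bar>x $ i\<bar>" "\<lambda>_. b"] assms by auto

text \<open>Coordinates are added one at a time and the errors accumulate; each new error is the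
  one-dimensional one, weighted by products of bounded basis values. In the radius, the term with
  \<open>CARD('n)\<close> bounds the base points and b + r the extent of the lines.\<close>

lemma tensor_interp_error:
  fixes A :: "'n::finite set"
  assumes "1 \<le> r" "real r \<le> b"
  shows "\<exists>C\<ge>0. \<forall>f::real^'n \<Rightarrow> real. \<forall>M. continuous_on UNIV f \<longrightarrow> 0 \<le> M \<longrightarrow>
     diff_bounded r (real CARD('n) * b + b + real r) M f \<longrightarrow>
     (\<forall>x. (\<forall>i. \<bar>x $ i\<bar> \<le> b) \<longrightarrow> \<bar>f x - tensor_interp r A f x\<bar> \<le> C * M)"
proof -
  obtain C1 where C1: "C1 \<ge> 0" "\<And>g M t. continuous_on UNIV g \<Longrightarrow> 0 \<le> M \<Longrightarrow>
     (\<And>x h. \<bar>x\<bar> \<le> b + real r \<Longrightarrow> 1 / (4 * real r) \<le> h \<Longrightarrow> h \<le> 1/2 \<Longrightarrow> \<bar>fdiff r g h x\<bar> \<le> M) \<Longrightarrow>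
     \<bar>t\<bar> \<le> b \<Longrightarrow> \<bar>g t - (\<Sum>k<r. poly (lagrange_basis r k) t * g (real k))\<bar> \<le> C1 * M"
    using lagrange_interpolation_error[OF assms] by blast
  obtain B where B: "B \<ge> 0" "\<And>k t. k < r \<Longrightarrow> \<bar>t\<bar> \<le> b \<Longrightarrow> \<bar>poly (lagrange_basis r k) t\<bar> \<le> B"
    using lagrange_basis_bounded[of r b] by blast
  have "finite A" by simp
  then show ?thesis
  proof (induction A rule: finite_induct)
    case empty
    have "tensor_interp r {} f x = f x" for f :: "real^'n \<Rightarrow> real" and x
      by (simp add: tensor_interp_def)
    then show ?case by (intro exI[of _ 0]) auto
  next
    case (insert a A)
    from insert.IH obtain C where C: "C \<ge> 0"
      "\<And>(f::real^'n \<Rightarrow> real) M x. continuous_on UNIV f \<Longrightarrow> 0 \<le> M \<Longrightarrow>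
        diff_bounded r (real CARD('n) * b + b + real r) M f \<Longrightarrow>
        (\<And>i. \<bar>x $ i\<bar> \<le> b) \<Longrightarrow> \<bar>f x - tensor_interp r A f x\<bar> \<le> C * M"
      by blast
    define D where "D = real (card (PiE A (\<lambda>_. {..<r}))) * (B ^ card A * C1)"
    have "\<bar>f x - tensor_interp r (insert a A) f x\<bar> \<le> (C + D) * M"
      if f: "continuous_on UNIV f" and M: "0 \<le> M"
        and db: "diff_bounded r (real CARD('n) * b + b + real r) M f"
        and x: "\<And>i. \<bar>x $ i\<bar> \<le> b" for f :: "real^'n \<Rightarrow> real" and M x
    proof -
      define p where "p k = (\<chi> i. if i \<in> A then real (k i) else if i = a then 0 else x $ i)"
        for k :: "'n \<Rightarrow> nat"
      define \<pi> where "\<pi> k = (\<Prod>i\<in>A. poly (lagrange_basis r (k i)) (x $ i))" for k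
      have p_eq: "(\<chi> i. if i \<in> A then real (k i) else x $ i) = p k + (x $ a) *\<^sub>R axis a 1" for k
        using \<open>a \<notin> A\<close> by (auto simp: vec_eq_iff axis_def p_def)
      have err: "\<bar>f (p k + (x $ a) *\<^sub>R axis a 1)
          - (\<Sum>j<r. poly (lagrange_basis r j) (x $ a) * f (p k + real j *\<^sub>R axis a 1))\<bar> \<le> C1 * M"
        if k: "k \<in> PiE A (\<lambda>_. {..<r})" for k
      proof (rule C1(2)[of "\<lambda>t. f (p k + t *\<^sub>R axis a 1)", OF _ M _ x])
        show "continuous_on UNIV (\<lambda>t. f (p k + t *\<^sub>R axis a 1))"
          by (intro continuous_on_compose2[OF f] continuous_intros) auto
        have "\<bar>p k $ i\<bar> \<le> b" for i
          using x[of i] PiE_mem[OF k, of i] assms by (auto simp: p_def)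
        then have "norm (p k) \<le> real CARD('n) * b"
          by (rule norm_le_card_mult)
        then show "\<bar>fdiff r (\<lambda>t. f (p k + t *\<^sub>R axis a 1)) h y\<bar> \<le> M"
          if "\<bar>y\<bar> \<le> b + real r" "1 / (4 * real r) \<le> h" "h \<le> 1/2" for y h
          using that assms by (intro diff_bounded_line[OF db]) auto
      qed
      have \<pi>: "\<bar>\<pi> k\<bar> \<le> B ^ card A" if k: "k \<in> PiE A (\<lambda>_. {..<r})" for k
        unfolding \<pi>_def abs_prod prod_constant[symmetric] using PiE_mem[OF k] B(2) x
        by (intro prod_mono) auto
      have "tensor_interp r A f x - tensor_interp r (insert a A) f x
        = (\<Sum>k\<in>PiE A (\<lambda>_. {..<r}). \<pi> k * (f (p k + (x $ a) *\<^sub>R axis a 1)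
          - (\<Sum>j<r. poly (lagrange_basis r j) (x $ a) * f (p k + real j *\<^sub>R axis a 1))))"
        unfolding tensor_interp_insert[OF \<open>a \<notin> A\<close>]
        unfolding tensor_interp_def p_eq
        by (simp add: p_def \<pi>_def sum_subtractf right_diff_distrib)
      also have "\<bar>\<dots>\<bar> \<le> (\<Sum>k\<in>PiE A (\<lambda>_. {..<r}). B ^ card A * (C1 * M))"
        using err \<pi> B(1) by (intro order_trans[OF sum_abs] sum_mono) (auto simp: abs_mult intro!: mult_mono)
      also have "\<dots> = D * M" by (simp add: D_def)
      finally show ?thesis
        using C(2)[OF f M db x] by (simp add: algebra_simps)
    qed
    moreover have "C + D \<ge> 0" using C(1) B(1) C1(1) by (simp add: D_def)
    ultimately show ?case by blast
  qed
qed

lemma monom_scaleR: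
  fixes x :: "real^'n::finite"
  shows "Defs.monom \<beta> (t *\<^sub>R x) = t ^ (\<Sum>i\<in>UNIV. \<beta> i) * Defs.monom \<beta> x"
  by (simp add: Defs.monom_def power_mult_distrib prod.distrib power_sum)

lemma tensor_interp_UNIV_monomials:
  fixes f :: "real^'n::finite \<Rightarrow> real"
  shows "\<exists>c. \<forall>x. tensor_interp r UNIV f x = (\<Sum>\<beta>\<in>PiE UNIV (\<lambda>_. {..<r}). c \<beta> * Defs.monom \<beta> x)"
proof -
  let ?P = "PiE (UNIV :: 'n set) (\<lambda>_. {..<r})"
  define c where "c \<beta> = (\<Sum>k\<in>?P. (\<Prod>i\<in>UNIV. coeff (lagrange_basis r (k i)) (\<beta> i)) * f (\<chi> i. real (k i)))" for \<beta>
  have "tensor_interp r UNIV f x = (\<Sum>\<beta>\<in>?P. c \<beta> * Defs.monom \<beta> x)" for x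
  proof -
    have "poly (lagrange_basis r k) t = (\<Sum>b<r. coeff (lagrange_basis r k) b * t ^ b)" if "k < r" for k t
      unfolding poly_altdef using degree_lagrange_basis[OF that]
      by (intro sum.mono_neutral_left) (auto simp: coeff_eq_0)
    then have "(\<Prod>i\<in>UNIV. poly (lagrange_basis r (k i)) (x $ i))
        = (\<Prod>i\<in>UNIV. \<Sum>b<r. coeff (lagrange_basis r (k i)) b * (x $ i) ^ b)" if "k \<in> ?P" for k
      using that by (intro prod.cong) (auto simp: PiE_iff)
    also have "\<dots> k = (\<Sum>\<beta>\<in>?P. (\<Prod>i\<in>UNIV. coeff (lagrange_basis r (k i)) (\<beta> i)) * Defs.monom \<beta> x)" for k
      by (subst prod_sum_PiE) (auto simp: prod.distrib Defs.monom_def)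
    finally have *: "(\<Prod>i\<in>UNIV. poly (lagrange_basis r (k i)) (x $ i)) =
       (\<Sum>\<beta>\<in>?P. (\<Prod>i\<in>UNIV. coeff (lagrange_basis r (k i)) (\<beta> i)) * Defs.monom \<beta> x)" if "k \<in> ?P" for k
      using that by blast
    have "tensor_interp r UNIV f x = (\<Sum>k\<in>?P. \<Sum>\<beta>\<in>?P. (\<Prod>i\<in>UNIV. coeff (lagrange_basis r (k i)) (\<beta> i))
        * Defs.monom \<beta> x * f (\<chi> i. real (k i)))"
      unfolding tensor_interp_def by (intro sum.cong) (auto simp: * sum_distrib_right)
    also have "\<dots> = (\<Sum>\<beta>\<in>?P. c \<beta> * Defs.monom \<beta> x)"
      by (subst sum.swap) (simp add: c_def sum_distrib_left sum_distrib_right mult_ac)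
    finally show ?thesis .
  qed
  then show ?thesis by blast
qed

text \<open>Tensor interpolation produces a polynomial of coordinate degree below \<open>r\<close>, but only
  monomials of total degree below \<open>r\<close> are wanted. On each line through the origin the
  interpolant is close to a polynomial of degree below \<open>r\<close>, so its homogeneous parts of
  degree at least \<open>r\<close> are of size \<open>M\<close> and may be dropped.\<close>
lemma whitney_euclidean:
  assumes r: "1 \<le> r"
  shows "\<exists>C\<ge>0. \<exists>\<rho>>0. \<forall>f::real^'n::finite \<Rightarrow> real. \<forall>M. continuous_on UNIV f \<longrightarrow> 0 \<le> M \<longrightarrow>
     diff_bounded r \<rho> M f \<longrightarrow>
     (\<exists>c. \<forall>x. norm x \<le> b0 \<longrightarrow>
        \<bar>f x - (\<Sum>\<beta>\<in>{\<beta>\<in>PiE UNIV (\<lambda>_. {..<r}). (\<Sum>i\<in>UNIV. \<beta> i) < r}. c \<beta> * Defs.monom \<beta> x)\<bar> \<le> C * M)"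
proof -
  \<comment> \<open>\<open>N\<close> exceeds r and every total degree in the tensor interpolant. As
    \<open>b\<close> is at least \<open>N\<close>, the points 0, ..., N-1 on each ray lie where both
    approximations hold.\<close>
  define N where "N = CARD('n) * r + 1"
  define b where "b = \<bar>b0\<bar> + real N"
  have "r \<le> CARD('n) * r" by simp
  then have rN: "real r \<le> real N" unfolding N_def of_nat_le_iff by linarith
  then have b: "real r \<le> b" "0 \<le> b" "real N \<le> b" "b0 \<le> b" by (auto simp: b_def)
  define \<rho> where "\<rho> = real CARD('n) * b + b + real r"
  let ?P = "PiE (UNIV :: 'n set) (\<lambda>_. {..<r})"
  have fin: "finite ?P" by (intro finite_PiE) auto
  obtain C1 where C1: "C1 \<ge> 0" "\<And>(f::real^'n \<Rightarrow> real) M x. continuous_on UNIV f \<Longrightarrow> 0 \<le> M \<Longrightarrow>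
     diff_bounded r \<rho> M f \<Longrightarrow> (\<And>i. \<bar>x $ i\<bar> \<le> b) \<Longrightarrow> \<bar>f x - tensor_interp r UNIV f x\<bar> \<le> C1 * M"
    using tensor_interp_error[OF r b(1), of "UNIV :: 'n set"] unfolding \<rho>_def by blast
  obtain B where B: "B \<ge> 0" "\<And>p K d. degree p < N \<Longrightarrow> (\<And>k. k < N \<Longrightarrow> \<bar>poly p (real k)\<bar> \<le> K) \<Longrightarrow>
      d < N \<Longrightarrow> \<bar>coeff p d\<bar> \<le> B * K"
    using lagrange_coeff_bounded[of N] by blast
  define W where "W = 1 + (8 * real r * b) ^ r"
  have W: "W \<ge> 0" using b by (simp add: W_def)
  define E where "E = (\<Sum>d\<in>{r..<N}. b ^ d * (B * (C1 + W)))"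
  have E: "E \<ge> 0" using b B(1) C1(1) W by (auto simp: E_def intro!: sum_nonneg)
  have "\<exists>c. \<forall>x. norm x \<le> b0 \<longrightarrow>
        \<bar>f x - (\<Sum>\<beta>\<in>{\<beta>\<in>?P. (\<Sum>i\<in>UNIV. \<beta> i) < r}. c \<beta> * Defs.monom \<beta> x)\<bar> \<le> (C1 + E) * M"
    if f: "continuous_on UNIV f" and M: "0 \<le> M" and db: "diff_bounded r \<rho> M f"
    for f :: "real^'n \<Rightarrow> real" and M
  proof -
    obtain c where c: "\<And>x. tensor_interp r UNIV f x = (\<Sum>\<beta>\<in>?P. c \<beta> * Defs.monom \<beta> x)"
      using tensor_interp_UNIV_monomials[of r f] by blast
    define H where "H d x = (\<Sum>\<beta>\<in>{\<beta>\<in>?P. (\<Sum>i\<in>UNIV. \<beta> i) = d}. c \<beta> * Defs.monom \<beta> x)" for d x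
    have H_hom: "H d (t *\<^sub>R x) = t ^ d * H d x" for d t x
      by (simp add: H_def monom_scaleR sum_distrib_left mult_ac)
    have deg: "(\<Sum>i\<in>UNIV. \<beta> i) < N" if "\<beta> \<in> ?P" for \<beta>
      using sum_bounded_above[of UNIV \<beta> r] that by (auto simp: PiE_iff N_def less_imp_le less_Suc_eq_le)
    have H_sum: "(\<Sum>\<beta>\<in>{\<beta>\<in>?P. (\<Sum>i\<in>UNIV. \<beta> i) < m}. c \<beta> * Defs.monom \<beta> x) = (\<Sum>d<m. H d x)" for m x
    proof -
      have "(\<Sum>d<m. H d x) = (\<Sum>d<m. \<Sum>\<beta>\<in>{\<beta>\<in>{\<beta>\<in>?P. (\<Sum>i\<in>UNIV. \<beta> i) < m}. (\<Sum>i\<in>UNIV. \<beta> i) = d}.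
          c \<beta> * Defs.monom \<beta> x)"
        unfolding H_def by (intro sum.cong) auto
      also have "\<dots> = (\<Sum>\<beta>\<in>{\<beta>\<in>?P. (\<Sum>i\<in>UNIV. \<beta> i) < m}. c \<beta> * Defs.monom \<beta> x)"
        using fin by (intro sum.group) auto
      finally show ?thesis ..
    qed
    have "{\<beta>\<in>?P. (\<Sum>i\<in>UNIV. \<beta> i) < N} = ?P" using deg by auto
    with H_sum[where m = N] have tensor_H: "tensor_interp r UNIV f x = (\<Sum>d<N. H d x)" for x
      by (simp add: c)
    have H_unit: "\<bar>H d u\<bar> \<le> B * ((C1 + W) * M)" if u: "norm u = 1" and d: "r \<le> d" "d < N" for u d
    proof -
      have "continuous_on UNIV (\<lambda>t::real. f (0 + t *\<^sub>R u))"
        by (intro continuous_on_compose2[OF f] continuous_intros) auto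
      moreover have "\<bar>fdiff r (\<lambda>t. f (0 + t *\<^sub>R u)) h x\<bar> \<le> M"
        if "\<bar>x\<bar> \<le> b + real r" "1 / (4 * real r) \<le> h" "h \<le> 1/2" for x h
        using that r b by (intro diff_bounded_line[OF db u]) (auto simp: \<rho>_def)
      ultimately obtain Q where Q: "degree Q < r" "\<And>t. \<bar>t\<bar> \<le> b \<Longrightarrow> \<bar>f (t *\<^sub>R u) - poly Q t\<bar> \<le> W * M"
        using whitney_real[of "\<lambda>t. f (0 + t *\<^sub>R u)" r M b] r M b unfolding W_def by auto
      \<comment> \<open>Along u, interpolant and Whitney polynomial are both near \<open>f\<close>
        at 0, ..., N-1, so \<open>p\<close> has small coefficients; from degree r on these are
        exactly \<open>H d u\<close>, since \<open>Q\<close> has smaller degree.\<close>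
      define p where "p = (\<Sum>d<N. Polynomial.monom (H d u) d) - Q"
      have "degree (\<Sum>d<N. Polynomial.monom (H d u) d) < N"
        by (intro degree_sum_less) (auto intro: le_less_trans[OF degree_monom_le] simp: N_def)
      then have "degree p < N"
        unfolding p_def using Q(1) rN by (intro degree_diff_less) auto
      moreover have "\<bar>poly p (real k)\<bar> \<le> (C1 + W) * M" if "k < N" for k
      proof -
        have "poly p (real k) = tensor_interp r UNIV f (real k *\<^sub>R u) - poly Q (real k)"
          by (simp add: p_def poly_sum poly_monom tensor_H H_hom mult.commute)
        moreover have "\<bar>f (real k *\<^sub>R u) - tensor_interp r UNIV f (real k *\<^sub>R u)\<bar> \<le> C1 * M"
        proof (rule C1(2)[OF f M db])
          fix i
          have "\<bar>(real k *\<^sub>R u) $ i\<bar> \<le> norm (real k *\<^sub>R u)" by (rule component_le_norm_cart)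
          then show "\<bar>(real k *\<^sub>R u) $ i\<bar> \<le> b" using u that b(3) by simp
        qed
        moreover have "\<bar>f (real k *\<^sub>R u) - poly Q (real k)\<bar> \<le> W * M"
          using that b(3) by (intro Q(2)) simp
        ultimately show ?thesis by (simp add: algebra_simps)
      qed
      ultimately have "\<bar>coeff p d\<bar> \<le> B * ((C1 + W) * M)"
        using B(2) d by blast
      moreover have "coeff p d = H d u"
        using d Q(1) by (simp add: p_def coeff_sum coeff_eq_0)
      ultimately show ?thesis by simp
    qed
    have H_high: "\<bar>H d x\<bar> \<le> b ^ d * (B * (C1 + W)) * M" if x: "norm x \<le> b" and d: "r \<le> d" "d < N" for x d
    proof -
      obtain u :: "real^'n" where u: "norm u = 1" "x = norm x *\<^sub>R u"
      proof (cases "x = 0")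
        case True
        obtain u :: "real^'n" where "norm u = 1" using vector_choose_size[of 1] by auto
        with True that show ?thesis by simp
      next
        case False
        with that[of "x /\<^sub>R norm x"] show ?thesis by simp
      qed
      have "\<bar>H d x\<bar> = norm x ^ d * \<bar>H d u\<bar>"
        by (subst u(2)) (simp add: H_hom abs_mult)
      also have "\<dots> \<le> b ^ d * (B * ((C1 + W) * M))"
        using H_unit[OF u(1) d] x b by (intro mult_mono power_mono) auto
      finally show ?thesis by (simp add: mult_ac)
    qed
    have "\<bar>f x - (\<Sum>\<beta>\<in>{\<beta>\<in>?P. (\<Sum>i\<in>UNIV. \<beta> i) < r}. c \<beta> * Defs.monom \<beta> x)\<bar> \<le> (C1 + E) * M"
      if x: "norm x \<le> b0" for x
    proof -
      have "\<bar>x $ i\<bar> \<le> b" for i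
        using component_le_norm_cart[of x i] x b(4) by simp
      then have 1: "\<bar>f x - tensor_interp r UNIV f x\<bar> \<le> C1 * M"
        by (rule C1(2)[OF f M db])
      have "(\<Sum>d<N. H d x) = (\<Sum>d<r. H d x) + (\<Sum>d\<in>{r..<N}. H d x)"
        using rN by (subst sum.union_disjoint[symmetric]) (auto intro!: sum.cong)
      moreover have "\<bar>\<Sum>d\<in>{r..<N}. H d x\<bar> \<le> (\<Sum>d\<in>{r..<N}. b ^ d * (B * (C1 + W)) * M)"
        using H_high x b(4) by (intro order_trans[OF sum_abs] sum_mono) auto
      ultimately show ?thesis
        using 1 unfolding H_sum tensor_H by (simp add: E_def algebra_simps sum_distrib_right sum_distrib_left)
    qed
    then show ?thesis by blast
  qed
  moreover have "C1 + E \<ge> 0" using C1(1) E by simp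
  moreover have "\<rho> > 0" using b r by (auto simp: \<rho>_def intro!: add_nonneg_pos)
  ultimately show ?thesis by blast
qed

subsection \<open>Wavelet coefficients and central differences\<close>

lemma Ck_imp_continuous: "Ck k f \<Longrightarrow> continuous_on UNIV f"
  by (cases k) auto

lemma continuous_on_monom: "continuous_on S (Defs.monom \<alpha>)"
  unfolding Defs.monom_def by (intro continuous_intros)

lemma integrable_mult_compact_supp:
  fixes g \<psi> :: "real^'n::finite \<Rightarrow> real"
  assumes "continuous_on UNIV g" "continuous_on UNIV \<psi>" "compact_supp \<psi>"
  shows "integrable lborel (\<lambda>x. g x * \<psi> x)"
proof -
  let ?K = "closure {x. \<psi> x \<noteq> 0}"
  have "integrable lborel (\<lambda>x. indicator ?K x *\<^sub>R (g x * \<psi> x))"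
    using assms unfolding compact_supp_def
    by (intro borel_integrable_compact continuous_on_mult) (auto intro: continuous_on_subset)
  moreover have "indicator ?K x *\<^sub>R (g x * \<psi> x) = g x * \<psi> x" for x
    using closure_subset[of "{x. \<psi> x \<noteq> 0}"] by (auto simp: indicator_def)
  ultimately show ?thesis by (simp only:)
qed

text \<open>Subtracting the Whitney polynomial leaves the integral unchanged. On a ball containing
  the support the difference is at most C M, and the L1 norm \<open>J\<close> of
  \<open>\<psi>\<close> does the rest.\<close>

lemma vanishing_moments_functional_bound:
  fixes \<psi> :: "real^'n::finite \<Rightarrow> real"
  assumes r: "1 \<le> r" and \<psi>: "continuous_on UNIV \<psi>" "compact_supp \<psi>"
    and moments: "\<And>\<alpha>::'n \<Rightarrow> nat. (\<Sum>i\<in>UNIV. \<alpha> i) < r \<Longrightarrow> (LINT x|lborel. Defs.monom \<alpha> x * \<psi> x) = 0"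
  shows "\<exists>C\<ge>0. \<exists>\<rho>>0. \<forall>f M. continuous_on UNIV f \<longrightarrow> 0 \<le> M \<longrightarrow> diff_bounded r \<rho> M f \<longrightarrow>
     \<bar>LINT x|lborel. f x * \<psi> x\<bar> \<le> C * M"
proof -
  obtain b where b: "\<And>x. \<psi> x \<noteq> 0 \<Longrightarrow> norm x \<le> b"
    using compact_imp_bounded[OF \<psi>(2)[unfolded compact_supp_def]] closure_subset[of "{x. \<psi> x \<noteq> 0}"]
    unfolding bounded_iff by blast
  let ?P = "{\<beta>\<in>PiE (UNIV :: 'n set) (\<lambda>_. {..<r}). (\<Sum>i\<in>UNIV. \<beta> i) < r}"
  obtain C \<rho> where C: "C \<ge> 0" "\<rho> > 0" and W: "\<And>(f::real^'n \<Rightarrow> real) M. continuous_on UNIV f \<Longrightarrow> 0 \<le> M \<Longrightarrow>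
     diff_bounded r \<rho> M f \<Longrightarrow>
     \<exists>c. \<forall>x. norm x \<le> b \<longrightarrow> \<bar>f x - (\<Sum>\<beta>\<in>?P. c \<beta> * Defs.monom \<beta> x)\<bar> \<le> C * M"
    using whitney_euclidean[OF r, of b] by blast
  note int = integrable_mult_compact_supp[OF _ \<psi>]
  define J where "J = (LINT x|lborel. \<bar>\<psi> x\<bar>)"
  have int_abs: "integrable lborel (\<lambda>x. \<bar>\<psi> x\<bar>)"
    using int[of "\<lambda>_. 1"] by (simp add: integrable_abs)
  have "\<bar>LINT x|lborel. f x * \<psi> x\<bar> \<le> (C * J) * M"
    if f: "continuous_on UNIV f" and M: "0 \<le> M" and db: "diff_bounded r \<rho> M f" for f M
  proof -
    obtain c where c: "\<And>x. norm x \<le> b \<Longrightarrow> \<bar>f x - (\<Sum>\<beta>\<in>?P. c \<beta> * Defs.monom \<beta> x)\<bar> \<le> C * M"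
      using W[OF f M db] by blast
    define p where "p x = (\<Sum>\<beta>\<in>?P. c \<beta> * Defs.monom \<beta> x)" for x
    have cont_p: "continuous_on UNIV p"
      unfolding p_def by (intro continuous_intros continuous_on_monom)
    have "(LINT x|lborel. p x * \<psi> x) = (LINT x|lborel. (\<Sum>\<beta>\<in>?P. c \<beta> * (Defs.monom \<beta> x * \<psi> x)))"
      by (simp add: p_def sum_distrib_right mult.assoc)
    also have "\<dots> = (\<Sum>\<beta>\<in>?P. (LINT x|lborel. c \<beta> * (Defs.monom \<beta> x * \<psi> x)))"
      by (intro Bochner_Integration.integral_sum integrable_mult_right int continuous_on_monom)
    also have "\<dots> = 0" by (intro sum.neutral) (auto simp: moments)
    finally have "(LINT x|lborel. f x * \<psi> x) = (LINT x|lborel. (f x - p x) * \<psi> x)"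
      by (simp add: left_diff_distrib Bochner_Integration.integral_diff int f cont_p)
    also have "\<bar>\<dots>\<bar> \<le> (LINT x|lborel. \<bar>(f x - p x) * \<psi> x\<bar>)"
      by (rule integral_abs_bound)
    also have "\<dots> \<le> (LINT x|lborel. C * M * \<bar>\<psi> x\<bar>)"
    proof (rule integral_mono)
      show "integrable lborel (\<lambda>x. \<bar>(f x - p x) * \<psi> x\<bar>)"
        by (intro integrable_abs int continuous_intros f cont_p)
      show "integrable lborel (\<lambda>x. C * M * \<bar>\<psi> x\<bar>)"
        by (intro integrable_mult_right int_abs)
      show "\<bar>(f x - p x) * \<psi> x\<bar> \<le> C * M * \<bar>\<psi> x\<bar>" for x
        using c[of x] b[of x] by (cases "\<psi> x = 0") (auto simp: abs_mult p_def intro!: mult_right_mono)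
    qed
    also have "\<dots> = C * J * M" by (simp add: J_def)
    finally show ?thesis .
  qed
  moreover have "C * J \<ge> 0" using C(1) by (simp add: J_def)
  ultimately show ?thesis using C(2) by blast
qed

text \<open>Substitution x = a (k + z) with a = 2^-j: the Jacobian a^n times the normalisation
  2^(jn/2) is 2^(-jn/2).\<close>

lemma LINT_wav:
  fixes f g :: "real^'n::finite \<Rightarrow> real"
  assumes "continuous_on UNIV f" "continuous_on UNIV g"
  shows "(LINT x|lborel. f x * wav g j k x) = 2 powr (- real_of_int j * real CARD('n) / 2) *
     (LINT z|lborel. f (2 powr (- real_of_int j) *\<^sub>R (\<chi> i. of_int (k i)) + 2 powr (- real_of_int j) *\<^sub>R z) * g z)"
proof -
  define a where "a = 2 powr (- real_of_int j)"
  define t :: "real^'n" where "t = a *\<^sub>R (\<chi> i. of_int (k i))"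
  have a: "a > 0" "2 powr (real_of_int j) * a = 1"
    by (auto simp: a_def powr_minus)
  have [measurable]: "f \<in> borel_measurable borel" "g \<in> borel_measurable borel"
    using assms by (auto intro: borel_measurable_continuous_onI)
  have [measurable]: "(\<lambda>x. f x * wav g j k x) \<in> borel_measurable borel"
    unfolding wav_def by measurable
  have g_arg: "2 powr (real_of_int j) *\<^sub>R (t + a *\<^sub>R z) - (\<chi> i. of_int (k i)) = z" for z
    by (simp add: t_def scaleR_right_distrib a(2))
  have "(LINT x|lborel. f x * wav g j k x) =
     (LINT x|density (distr lborel borel (\<lambda>x. t + a *\<^sub>R x)) (\<lambda>_. ennreal (\<bar>a\<bar> ^ DIM(real^'n))). f x * wav g j k x)"
    using lborel_affine[of a t] a by simp
  also have "\<dots> = (LINT x|distr lborel borel (\<lambda>x. t + a *\<^sub>R x). a ^ CARD('n) *\<^sub>R (f x * wav g j k x))"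
    using a by (subst integral_density) auto
  also have "\<dots> = (LINT z|lborel. a ^ CARD('n) *\<^sub>R (f (t + a *\<^sub>R z) * wav g j k (t + a *\<^sub>R z)))"
    by (subst integral_distr) auto
  also have "\<dots> = (LINT z|lborel. (a ^ CARD('n) * 2 powr (real_of_int j * real CARD('n) / 2)) *
      (f (t + a *\<^sub>R z) * g z))"
    unfolding wav_def g_arg by (simp add: mult_ac)
  also have "a ^ CARD('n) * 2 powr (real_of_int j * real CARD('n) / 2) = 2 powr (- real_of_int j * real CARD('n) / 2)"
    unfolding a_def by (simp add: powr_powr powr_add[symmetric] flip: powr_realpow)
  finally show ?thesis by (simp add: a_def t_def)
qed

text \<open>The half-open cube lies between an open and a closed box of equal volume.\<close>

lemma measure_dcube:
  "measure lborel (dcube j k :: (real^'n::finite) set) = 2 powr (- real_of_int j * real CARD('n))"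
proof -
  define a where "a = 2 powr (- real_of_int j)"
  define l u :: "real^'n" where "l = (\<chi> i. a * of_int (k i))" and "u = (\<chi> i. a * (of_int (k i) + 1))"
  have a: "a > 0" by (simp add: a_def)
  then have le: "l \<bullet> e \<le> u \<bullet> e" if "e \<in> Basis" for e
    using that by (auto simp: Basis_vec_def l_def u_def inner_axis algebra_simps)
  have vol: "(\<Prod>e\<in>Basis. (u - l) \<bullet> e) = a ^ CARD('n)"
  proof -
    have "(u - l) \<bullet> e = a" if "e \<in> Basis" for e
      using that by (auto simp: Basis_vec_def l_def u_def inner_axis algebra_simps)
    then show ?thesis by simp
  qed
  have sub: "box l u \<subseteq> dcube j k" "dcube j k \<subseteq> cbox l u"
    by (auto simp: dcube_def l_def u_def a_def mem_box_cart less_imp_le)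
  have meas: "(dcube j k :: (real^'n) set) \<in> sets lborel"
    unfolding dcube_def by measurable
  have "emeasure lborel (dcube j k :: (real^'n) set) = ennreal (a ^ CARD('n))"
  proof (rule antisym)
    show "emeasure lborel (dcube j k :: (real^'n) set) \<le> ennreal (a ^ CARD('n))"
      using emeasure_mono[OF sub(2), of lborel] le vol by simp
    show "ennreal (a ^ CARD('n)) \<le> emeasure lborel (dcube j k :: (real^'n) set)"
      using emeasure_mono[OF sub(1) meas] le vol by simp
  qed
  then have "measure lborel (dcube j k :: (real^'n) set) = a ^ CARD('n)"
    using a by (simp add: measure_def)
  then show ?thesis by (simp add: a_def powr_powr flip: powr_realpow)
qed

text \<open>\<open>DeltaPow\<close> recurses on the differenced function, \<open>fdiff\<close>
  differences the result; this exchanges the two orders.\<close>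

lemma DeltaPow_Delta1:
  "DeltaPow r h (Delta1 h f) x = DeltaPow r h f (x + (1/2) *\<^sub>R h) - DeltaPow r h f (x - (1/2) *\<^sub>R h)"
  by (induction r arbitrary: f x) (auto simp: Delta1_def)

text \<open>Both sides sample x, x + h, ..., x + r h, whose centre is x + (r/2) h.\<close>

lemma fdiff_eq_DeltaPow:
  "fdiff r f h x = (-1) ^ r * DeltaPow r h f (x + (real r / 2) *\<^sub>R h)"
proof (induction r arbitrary: x)
  case (Suc r)
  have "x + (real (Suc r) / 2) *\<^sub>R h - (1/2) *\<^sub>R h = x + (real r / 2) *\<^sub>R h"
    "x + (real (Suc r) / 2) *\<^sub>R h + (1/2) *\<^sub>R h = x + h + (real r / 2) *\<^sub>R h"
    by (auto simp: vec_eq_iff field_simps)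
  then show ?case
    by (simp add: Suc.IH DeltaPow_Delta1 algebra_simps)
qed simp

lemma abs_fdiff_le:
  assumes "\<And>x. \<bar>f x\<bar> \<le> B"
  shows "\<bar>fdiff r f h x\<bar> \<le> 2 ^ r * B"
proof (induction r arbitrary: x)
  case (Suc r)
  show ?case using Suc.IH[of x] Suc.IH[of "x + h"] by simp
qed (use assms in simp)

text \<open>Boundedness of \<open>f\<close> makes the differences bounded above, so that the
  real-valued \<open>SUP\<close> really dominates its members.\<close>

lemma fdiff_le_DeltaR:
  assumes "bounded (range f)"
  shows "\<bar>fdiff r f h x\<bar> \<le> DeltaR r f (x + (real r / 2) *\<^sub>R h) (norm h)"
proof -
  obtain B where B: "\<And>x. \<bar>f x\<bar> \<le> B"
    using assms by (auto simp: bounded_iff)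
  have "\<bar>DeltaPow r h' f y\<bar> \<le> 2 ^ r * B" for h' y
    using abs_fdiff_le[of f B r h' "y - (real r / 2) *\<^sub>R h'"] B
    by (simp add: fdiff_eq_DeltaPow abs_mult power_abs)
  then have "bdd_above ((\<lambda>h'. \<bar>DeltaPow r h' f y\<bar>) ` {h'. norm h' = norm h})" for y
    by (intro bdd_aboveI2)
  then show ?thesis
    unfolding fdiff_eq_DeltaPow DeltaR_def
    by (auto simp: abs_mult power_abs intro!: cSUP_upper2)
qed

subsection \<open>Comparison at dyadic scales\<close>

text \<open>Meant for a height divided by the side length of the cube: the bound 1/2 is why layers
  start at 1, the lower bound why m of them suffice.\<close>

lemma dyadic_scale:
  fixes v :: real
  assumes "v \<le> 1/2" "2 powr (- real m - 1) < v"
  shows "\<exists>i\<in>{1..m}. 2 powr (- real i - 1) < v \<and> v \<le> 2 powr (- real i)"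
  using assms(2)
proof (induction m)
  case 0
  then show ?case using assms(1) by (simp add: powr_minus)
next
  case (Suc m)
  show ?case
  proof (cases "2 powr (- real m - 1) < v")
    case True
    then show ?thesis using Suc.IH by force
  next
    case False
    moreover have "- real (Suc m) = - real m - 1" by simp
    ultimately have "v \<le> 2 powr (- real (Suc m))" by (metis linorder_not_less)
    then show ?thesis using Suc.prems by (intro bexI[of _ "Suc m"]) auto
  qed
qed

lemma diff_bounded_mono: "diff_bounded r \<rho> M f \<Longrightarrow> \<rho>' \<le> \<rho> \<Longrightarrow> diff_bounded r \<rho>' M f"
  by (auto simp: diff_bounded_def)

text \<open>The argument of \<open>arcosh\<close> is scale invariant, so a^2 cancels and the bound
  depends on \<open>q\<close> and \<open>\<delta>\<close> alone.\<close>

lemma hyp_dist_bound: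
  assumes "0 < a" "norm (x - x') \<le> a * q" "a / 2 < y" "y \<le> a" "a * \<delta> < y'" "y' \<le> a" "0 < \<delta>"
  shows "hyp_dist (x, y) (x', y') \<le> arcosh (1 + (q\<^sup>2 + 1) / \<delta>)"
proof -
  have "0 < a * \<delta>" using assms by simp
  then have pos: "0 < y" "0 < y'" using assms by linarith+
  have "(norm (x - x'))\<^sup>2 \<le> (a * q)\<^sup>2" using assms by (intro power_mono) auto
  moreover have "(y - y')\<^sup>2 \<le> a\<^sup>2"
    using assms pos by (intro abs_le_square_iff[THEN iffD1]) auto
  ultimately have "(norm (x - x'))\<^sup>2 + (y - y')\<^sup>2 \<le> a\<^sup>2 * (q\<^sup>2 + 1)"
    by (simp add: algebra_simps power_mult_distrib)
  moreover have "a * (a * \<delta>) \<le> (2 * y) * y'"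
    using assms pos by (intro mult_mono) auto
  then have "a\<^sup>2 * \<delta> \<le> 2 * y * y'" by (simp add: power2_eq_square mult_ac)
  ultimately have "((norm (x - x'))\<^sup>2 + (y - y')\<^sup>2) / (2 * y * y') \<le> (a\<^sup>2 * (q\<^sup>2 + 1)) / (a\<^sup>2 * \<delta>)"
    using assms by (intro frac_le) auto
  also have "\<dots> = (q\<^sup>2 + 1) / \<delta>" using assms by simp
  finally have le: "((norm (x - x'))\<^sup>2 + (y - y')\<^sup>2) / (2 * y * y') \<le> (q\<^sup>2 + 1) / \<delta>" .
  have "0 \<le> ((norm (x - x'))\<^sup>2 + (y - y')\<^sup>2) / (2 * y * y')" using pos by simp
  with le show ?thesis
    unfolding hyp_dist_def fst_conv snd_conv
    by (subst linorder_not_less[symmetric], subst arcosh_less_iff_real) auto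
qed

lemma bchoice2:
  assumes "\<forall>x\<in>S. \<exists>y z. P x y z"
  shows "\<exists>f g. \<forall>x\<in>S. P x (f x) (g x)"
  using assms by metis

theorem mainTheorem9:
  fixes s :: real and r L :: nat
    and \<phi> :: "real^'n::finite \<Rightarrow> real" and \<psi> :: "nat \<Rightarrow> real^'n \<Rightarrow> real"
  assumes "0 < s" and "1 \<le> r" and "real r > s"
    and "daubechies L \<phi> \<psi>" and "L + 1 \<ge> r"
  shows "\<exists>c m R. 0 < c \<and> c < 1 \<and> 1 \<le> m \<and> 1 < R \<and>
     (\<forall>f \<in> Lambda s. \<forall>\<epsilon> > 0. \<forall>j::nat.
        T_set (int j) s \<psi> f \<epsilon>
          \<subseteq> (\<Union>i\<in>{j+1..j+m}. hyp_nbhd (S_set r (int i) s f (c * \<epsilon>)) R))"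
proof -
  define I where "I = {1..<(2::nat) ^ CARD('n)}"
  \<comment> \<open>Nonemptiness of the index set is what gives \<open>MAX\<close> its
    meaning.\<close>
  have "(2::nat) ^ 1 \<le> 2 ^ CARD('n)" by (intro power_increasing) auto
  then have I: "finite I" "I \<noteq> {}" by (auto simp: I_def)
  have \<psi>: "continuous_on UNIV (\<psi> l)" "compact_supp (\<psi> l)"
    "\<And>\<alpha>::'n \<Rightarrow> nat. (\<Sum>i\<in>UNIV. \<alpha> i) \<le> L \<Longrightarrow> (LINT x|lborel. Defs.monom \<alpha> x * \<psi> l x) = 0"
    if "l \<in> I" for l
    using assms(4) that by (auto simp: daubechies_def I_def intro: Ck_imp_continuous)
  \<comment> \<open>By \<open>L + 1 \<ge> r\<close>, total degree below r means total degree at most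
    L, where moments vanish.\<close>
  have "\<exists>C \<rho>. C \<ge> 0 \<and> \<rho> > 0 \<and> (\<forall>f M. continuous_on UNIV f \<longrightarrow> 0 \<le> M \<longrightarrow>
      diff_bounded r \<rho> M f \<longrightarrow> \<bar>LINT x|lborel. f x * \<psi> l x\<bar> \<le> C * M)" if "l \<in> I" for l
    using vanishing_moments_functional_bound[OF assms(2) \<psi>(1,2)[OF that] \<psi>(3)[OF that]] assms(5)
    by auto
  then have "\<exists>C \<rho>. \<forall>l\<in>I. C l \<ge> 0 \<and> \<rho> l > 0 \<and> (\<forall>f M. continuous_on UNIV f \<longrightarrow> 0 \<le> M \<longrightarrow>
      diff_bounded r (\<rho> l) M f \<longrightarrow> \<bar>LINT x|lborel. f x * \<psi> l x\<bar> \<le> C l * M)"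
    by (intro bchoice2) blast
  then obtain C \<rho>' where C: "\<And>l. l \<in> I \<Longrightarrow> C l \<ge> 0" "\<And>l. l \<in> I \<Longrightarrow> \<rho>' l > 0"
    "\<And>l f M. l \<in> I \<Longrightarrow> continuous_on UNIV f \<Longrightarrow> 0 \<le> M \<Longrightarrow> diff_bounded r (\<rho>' l) M f \<Longrightarrow>
     \<bar>LINT x|lborel. f x * \<psi> l x\<bar> \<le> C l * M"
    by blast
  \<comment> \<open>Sums dominate every \<open>C l\<close> and \<open>\<rho>' l\<close>, which makes
    the constants uniform in l; \<open>+ 1\<close> keeps \<open>K\<close> positive, whence c <
    1.\<close>
  define K where "K = (\<Sum>l\<in>I. C l) + 1"
  define \<rho> where "\<rho> = (\<Sum>l\<in>I. \<rho>' l)"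
  have K: "K \<ge> 1" "\<And>l. l \<in> I \<Longrightarrow> C l \<le> K"
    using C(1) I(1) by (auto simp: K_def intro!: sum_nonneg add_increasing2 member_le_sum)
  have \<rho>: "\<rho> \<ge> 0" "\<And>l. l \<in> I \<Longrightarrow> \<rho>' l \<le> \<rho>"
    using C(2)[THEN less_imp_le] I(1) by (auto simp: \<rho>_def intro!: sum_nonneg member_le_sum)
  define c where "c = 1 / (K + 1)"
  have c: "0 < c" "c < 1" "K * c \<le> 1" using K(1) by (auto simp: c_def field_simps)
  \<comment> \<open>Since 4r < 2^(4r), this many layers reach below the smallest step
    1/(4r).\<close>
  define m where "m = 4 * r"
  define \<delta> where "\<delta> = 2 powr (- real m - 1)"
  have "real m < 2 ^ m" using less_exp[of m] by (metis of_nat_less_iff of_nat_numeral of_nat_power)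
  moreover have "\<delta> \<le> 1 / 2 ^ m" by (simp add: \<delta>_def powr_diff powr_minus powr_realpow divide_simps)
  ultimately have \<delta>: "0 < \<delta>" "\<delta> < 1 / (4 * real r)"
    using assms(2) frac_less2[of 1 1 "real m" "2 ^ m"] by (auto simp: \<delta>_def m_def)
  \<comment> \<open>In units of the side length: the position of x in its cube, the base point z,
    and the shift from base point to centre of the difference. In \<open>R\<close>, the
    \<open>+ 2\<close> makes the distance bound strict and gives 1 < R.\<close>
  define q where "q = real CARD('n) + \<rho> + real r"
  define R where "R = arcosh (1 + (q\<^sup>2 + 1) / \<delta>) + 2"
  have "0 \<le> arcosh (1 + (q\<^sup>2 + 1) / \<delta>)" using \<delta> by (intro arcosh_nonneg_real) simp
  then have R: "1 < R" by (simp add: R_def)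
  have main: "p \<in> (\<Union>i\<in>{j+1..j+m}. hyp_nbhd (S_set r (int i) s f (c * \<epsilon>)) R)"
    if f: "f \<in> Lambda s" and \<epsilon>: "\<epsilon> > 0" and p: "p \<in> T_set (int j) s \<psi> f \<epsilon>" for f \<epsilon> j p
  proof (rule ccontr)
    assume contra: "p \<notin> (\<Union>i\<in>{j+1..j+m}. hyp_nbhd (S_set r (int i) s f (c * \<epsilon>)) R)"
    have f_cont: "continuous_on UNIV f" and f_bdd: "bounded (range f)"
      using f by (auto simp: Lambda_def)
    define a where "a = 2 powr (- real j)"
    have a: "0 < a" by (simp add: a_def)
    obtain k x y where k: "k \<in> W_set (int j) s \<psi> f \<epsilon>" and pxy: "p = (x, y)"
      and x: "x \<in> dcube (int j) k" and y: "a / 2 < y" "y \<le> a"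
      using p by (auto simp: T_set_def Tbox_def a_def)
    define \<kappa> :: "real^'n" where "\<kappa> = (\<chi> i. of_int (k i))"
    have x_near: "norm (x - a *\<^sub>R \<kappa>) \<le> real CARD('n) * a"
    proof (rule norm_le_card_mult)
      fix i
      show "\<bar>(x - a *\<^sub>R \<kappa>) $ i\<bar> \<le> a"
        using x by (auto simp: dcube_def a_def \<kappa>_def algebra_simps dest!: spec[of _ i])
    qed
    \<comment> \<open>Such a point lies in one of the m layers and within distance R of p, hence
      outside \<open>S_set\<close>; replacing y' by a uses y' \<le> a and s > 0.\<close>
    have far: "DeltaR r f x' y' \<le> c * \<epsilon> * a powr s"
      if x': "norm (x - x') \<le> a * q" and y': "a * (1 / (4 * real r)) \<le> y'" "y' \<le> a / 2" for x' y'
    proof -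
      have "a * \<delta> < a * (1 / (4 * real r))" using \<delta> a by (intro mult_strict_left_mono)
      then have low: "a * \<delta> < y'" using y' by simp
      then have y'0: "0 < y'" using a \<delta>(1) by (meson less_trans mult_pos_pos)
      obtain i where i: "i \<in> {1..m}" "2 powr (- real i - 1) < y' / a" "y' / a \<le> 2 powr (- real i)"
        using dyadic_scale[of "y' / a" m] low y' a by (auto simp: \<delta>_def field_simps)
      have i': "2 powr (- real (j + i) - 1) < y'" "y' \<le> 2 powr (- real (j + i))"
        using i(2,3) a by (auto simp: a_def field_simps powr_add powr_diff powr_minus)
      have "hyp_dist (x, y) (x', y') < R"
        using hyp_dist_bound[OF a x' y low _ \<delta>(1)] y' a unfolding R_def by fastforce
      moreover have "0 < y" using y a by linarith
      moreover have "j + i \<in> {j+1..j+m}" using i(1) by auto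
      ultimately have "(x', y') \<notin> S_set r (int (j + i)) s f (c * \<epsilon>)"
        using contra unfolding pxy hyp_nbhd_def by fastforce
      then have "DeltaR r f x' y' / y' powr s \<le> c * \<epsilon>"
        using i' y'0 by (auto simp: S_set_def not_less)
      then have "DeltaR r f x' y' \<le> c * \<epsilon> * y' powr s"
        using y'0 by (simp add: divide_le_eq)
      also have "\<dots> \<le> c * \<epsilon> * a powr s"
        using c \<epsilon> y' y'0 a assms(1) by (intro mult_left_mono powr_mono2) auto
      finally show ?thesis .
    qed
    define g where "g = (\<lambda>z. f (a *\<^sub>R \<kappa> + a *\<^sub>R z))"
    have g_cont: "continuous_on UNIV g"
      unfolding g_def by (intro continuous_on_compose2[OF f_cont] continuous_intros) auto
    have db: "diff_bounded r \<rho> (c * \<epsilon> * a powr s) g"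
      unfolding diff_bounded_def
    proof (intro allI impI)
      fix z v :: "real^'n"
      assume z: "norm z \<le> \<rho>" and v: "1 / (4 * real r) \<le> norm v" "norm v \<le> 1/2"
      have "linear (\<lambda>z::real^'n. a *\<^sub>R z)" by (simp add: linear_iff algebra_simps)
      from fdiff_linear_comp[OF this]
      have "fdiff r g v z = fdiff r f (a *\<^sub>R v) (a *\<^sub>R \<kappa> + a *\<^sub>R z)"
        unfolding g_def .
      then have "\<bar>fdiff r g v z\<bar> \<le> DeltaR r f (a *\<^sub>R \<kappa> + a *\<^sub>R z + (real r / 2) *\<^sub>R (a *\<^sub>R v)) (norm (a *\<^sub>R v))"
        by (simp only: fdiff_le_DeltaR[OF f_bdd])
      also have "\<dots> \<le> c * \<epsilon> * a powr s"
      proof (rule far)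
        have "norm (x - (p + p' + p'')) \<le> norm (x - p) + norm p' + norm p''" for p p' p'' :: "real^'n"
          by norm
        then have "norm (x - (a *\<^sub>R \<kappa> + a *\<^sub>R z + (real r / 2) *\<^sub>R (a *\<^sub>R v)))
          \<le> norm (x - a *\<^sub>R \<kappa>) + norm (a *\<^sub>R z) + norm ((real r / 2) *\<^sub>R (a *\<^sub>R v))"
          .
        also have "\<dots> \<le> real CARD('n) * a + a * \<rho> + a * real r"
        proof (intro add_mono x_near)
          show "norm (a *\<^sub>R z) \<le> a * \<rho>" using z a by simp
          have "real r / 2 * norm v \<le> real r * 1" using v by (intro mult_mono) auto
          from mult_left_mono[OF this, of a] a
          show "norm ((real r / 2) *\<^sub>R (a *\<^sub>R v)) \<le> a * real r" by (simp add: mult_ac)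
        qed
        finally show "norm (x - (a *\<^sub>R \<kappa> + a *\<^sub>R z + (real r / 2) *\<^sub>R (a *\<^sub>R v))) \<le> a * q"
          by (simp add: q_def algebra_simps)
        show "a * (1 / (4 * real r)) \<le> norm (a *\<^sub>R v)" "norm (a *\<^sub>R v) \<le> a / 2"
          using v a mult_left_mono[OF v(1), of a] mult_left_mono[OF v(2), of a] by auto
      qed
      finally show "\<bar>fdiff r g v z\<bar> \<le> c * \<epsilon> * a powr s" .
    qed
    define V where "V = 2 powr (- real j * real CARD('n) / 2)"
    have V: "V > 0" by (simp add: V_def)
    have small: "\<bar>LINT x|lborel. f x * wav (\<psi> l) (int j) k x\<bar> \<le> \<epsilon> * (V * a powr s)" if l: "l \<in> I" for l
    proof -
      have "\<bar>LINT z|lborel. g z * \<psi> l z\<bar> \<le> C l * (c * \<epsilon> * a powr s)"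
        using C(3)[OF l g_cont] diff_bounded_mono[OF db \<rho>(2)[OF l]] c \<epsilon> by simp
      also have "\<dots> \<le> K * (c * \<epsilon> * a powr s)"
        using K(2)[OF l] c \<epsilon> by (intro mult_right_mono) auto
      also have "\<dots> = (K * c) * (\<epsilon> * a powr s)" by simp
      also have "\<dots> \<le> 1 * (\<epsilon> * a powr s)"
        using c(3) \<epsilon> by (intro mult_right_mono) auto
      finally have *: "\<bar>LINT z|lborel. g z * \<psi> l z\<bar> \<le> \<epsilon> * a powr s" by simp
      have "(LINT x|lborel. f x * wav (\<psi> l) (int j) k x) = V * (LINT z|lborel. g z * \<psi> l z)"
        using LINT_wav[OF f_cont \<psi>(1)[OF l], of "int j" k] by (simp add: V_def g_def a_def \<kappa>_def)
      then show ?thesis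
        using mult_left_mono[OF *, of V] V by (simp add: abs_mult mult_ac)
    qed
    \<comment> \<open>The threshold |I|^(s/n + 1/2) splits into a^s and the factor \<open>V\<close>
      produced by rescaling the coefficient.\<close>
    have "measure lborel (dcube (int j) k :: (real^'n) set) powr (s / real CARD('n) + 1/2) = V * a powr s"
    proof -
      have "- real j * real CARD('n) * (s / real CARD('n) + 1/2)
          = - real j * real CARD('n) / 2 + - real j * s"
        by (simp add: distrib_left)
      then show ?thesis
        unfolding measure_dcube V_def a_def powr_powr powr_add[symmetric] by simp
    qed
    then have "\<epsilon> * (V * a powr s) < (MAX l\<in>I. \<bar>LINT x|lborel. f x * wav (\<psi> l) (int j) k x\<bar>)"
      using k by (simp add: W_set_def I_def)
    then show False
      using small I by (subst (asm) Max_gr_iff) (auto simp: not_less dest: leD)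
  qed
  show ?thesis
    using c R main assms(2) by (intro exI[of _ c] exI[of _ m] exI[of _ R]) (auto simp: m_def)
qed

end
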